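(* Let $\mathcal S\subset\mathbb H^1$ be an $H$-minimal entire graph with empty characteristic locus which is not itself a vertical plane $\{(x,y,t)\mid ax+by=\gamma\}$. Then there exists a strict graphical strip $\mathcal S_0\subset\mathcal S$. That is, after possibly composing with a suitable rotation about the $t$-axis and a left-translation, the transformed surface contains a portion of the form $\{(x,y,t)\mid (y,t)\in\mathbb R\times I,\ x=yG(t)\}$ or of the form $\{(x,y,t)\mid (x,t)\in\mathbb R\times I,\ y=-xG(t)\}$, for some interval $I\subset\mathbb R$ and some $G\in C^2(I)$ with $G'\ge0$ on $I$ and $G'>0$ on some subinterval of $I$.
   Context: $\mathbb H^1$ is $\mathbb R^3$ with the group law $(x,y,t)\circ(x',y',t')=(x+x',y+y',t+t'+\tfrac12(xy'-x'y))$. Left-invariant vector fields: $X_1=\partial_x-\tfrac y2\partial_t$, $X_2=\partial_y+\tfrac x2\partial_t$, $T=\partial_t$. The characteristic locus of a $C^2$ surface $\mathcal S$ is $\Sigma(\mathcal S)=\{g\in\mathcal S\mid T_g\mathcal S=\mathrm{span}\{X_1(g),X_2(g)\}\}$. If $\Sigma(\mathcal S)=\varnothing$, the $H$-mean curvature of $\mathcal S$ is, for a local $C^2$ defining function $\phi$, the restriction to $\mathcal S$ of $\mathcal H=X_1(X_1\phi/W)+X_2(X_2\phi/W)$, $W=\sqrt{(X_1\phi)^2+(X_2\phi)^2}$; $\mathcal S$ is $H$-minimal if $\mathcal H\equiv0$ on $\mathcal S$. Entire graph: a $C^2$ surface $\mathcal S\subset\mathbb H^1$ for which there is a plane $P=\{ax+by+ct=\gamma\}$,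 $(a,b,c)\ne0$, such that for every $g_0\in P$ the straight line $\{g_0+s(a,b,c)\mid s\in\mathbb R\}$ intersects $\mathcal S$ in exactly one point. Graphical strip: a $C^2$ surface for which there exist an (open) interval $I\subset\mathbb R$ and $G\in C^2(I)$ with $G'\ge0$ on $I$ such that, after possibly a left-translation and a rotation about the $t$-axis, it equals $\{(x,y,t)\mid (y,t)\in\mathbb R\times I,\ x=yG(t)\}$ or $\{(x,y,t)\mid (x,t)\in\mathbb R\times I,\ y=-xG(t)\}$. It is strict if moreover $G'>0$ on some (nonempty open) subinterval $J\subset I$. *)

theory Defs
  imports "HOL-Analysis.Analysis"
begin

text \<open>Points of the Heisenberg group, written \<open>(x, y, t)\<close>.\<close>

type_synonym heis = "real \<times> real \<times> real"

definition heis_mult :: "heis \<Rightarrow> heis \<Rightarrow> heis" (infixl "\<circ>\<^sub>H" 70) where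
  "heis_mult = (\<lambda>(x, y, t) (x', y', t').
     (x + x', y + y', t + t' + (x * y' - x' * y) / 2))"

definition rotation_t :: "real \<Rightarrow> heis \<Rightarrow> heis" where
  "rotation_t \<theta> = (\<lambda>(x, y, t).
     (x * cos \<theta> - y * sin \<theta>, x * sin \<theta> + y * cos \<theta>, t))"

definition X1 :: "heis \<Rightarrow> heis" where
  "X1 = (\<lambda>(x, y, t). (1, 0, - y / 2))"

definition X2 :: "heis \<Rightarrow> heis" where
  "X2 = (\<lambda>(x, y, t). (0, 1, x / 2))"

text \<open>A vector field \<open>X\<close> acting on a function as a first-order differential operator.\<close>

definition vf_apply :: "(heis \<Rightarrow> heis) \<Rightarrow> (heis \<Rightarrow> real) \<Rightarrow> heis \<Rightarrow> real" where
  "vf_apply X f g = frechet_derivative f (at g) (X g)"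

text \<open>The classes \<open>C\<^sup>1\<close> and \<open>C\<^sup>2\<close> on an open set. As the domain has finite dimension,
  continuity of all directional derivatives is continuity of the derivative.\<close>

definition C1_on :: "('a::euclidean_space \<Rightarrow> real) \<Rightarrow> 'a set \<Rightarrow> bool" where
  "C1_on f U \<longleftrightarrow> (\<forall>x\<in>U. f differentiable (at x)) \<and>
     (\<forall>v. continuous_on U (\<lambda>x. frechet_derivative f (at x) v))"

definition C2_on :: "('a::euclidean_space \<Rightarrow> real) \<Rightarrow> 'a set \<Rightarrow> bool" where
  "C2_on f U \<longleftrightarrow> (\<forall>x\<in>U. f differentiable (at x)) \<and>
     (\<forall>v. C1_on (\<lambda>x. frechet_derivative f (at x) v) U)"

definition C2_defining_function :: "heis set \<Rightarrow> heis set \<Rightarrow> (heis \<Rightarrow> real) \<Rightarrow> bool" where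
  "C2_defining_function S U \<phi> \<longleftrightarrow> open U \<and> C2_on \<phi> U \<and>
     (\<forall>g\<in>U. \<exists>v. frechet_derivative \<phi> (at g) v \<noteq> 0) \<and>
     S \<inter> U = {g \<in> U. \<phi> g = 0}"

definition C2_surface :: "heis set \<Rightarrow> bool" where
  "C2_surface S \<longleftrightarrow> (\<forall>g\<in>S. \<exists>U \<phi>. g \<in> U \<and> C2_defining_function S U \<phi>)"

text \<open>Tangent vectors are the velocities of \<open>C\<^sup>1\<close> curves in the surface.\<close>

definition tangent_space :: "heis set \<Rightarrow> heis \<Rightarrow> heis set" where
  "tangent_space S g = {v. \<exists>\<gamma> \<epsilon>. \<epsilon> > 0 \<and> \<gamma> C1_differentiable_on {-\<epsilon><..<\<epsilon>} \<and>
     \<gamma> ` {-\<epsilon><..<\<epsilon>} \<subseteq> S \<and> \<gamma> 0 = g \<and> (\<gamma> has_vector_derivative v) (at 0)}"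

definition characteristic_locus :: "heis set \<Rightarrow> heis set" where
  "characteristic_locus S = {g \<in> S. tangent_space S g = span {X1 g, X2 g}}"

definition hor_grad_norm :: "(heis \<Rightarrow> real) \<Rightarrow> heis \<Rightarrow> real" where
  "hor_grad_norm \<phi> g = sqrt ((vf_apply X1 \<phi> g)\<^sup>2 + (vf_apply X2 \<phi> g)\<^sup>2)"

definition H_mean_curvature :: "(heis \<Rightarrow> real) \<Rightarrow> heis \<Rightarrow> real" where
  "H_mean_curvature \<phi> g =
     vf_apply X1 (\<lambda>p. vf_apply X1 \<phi> p / hor_grad_norm \<phi> p) g +
     vf_apply X2 (\<lambda>p. vf_apply X2 \<phi> p / hor_grad_norm \<phi> p) g"

text \<open>For surfaces with empty characteristic locus. Up to sign, the value of
  \<^const>\<open>H_mean_curvature\<close> at points of the surface does not depend on the choice of the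
  local defining function.\<close>

definition H_minimal :: "heis set \<Rightarrow> bool" where
  "H_minimal S \<longleftrightarrow> (\<forall>U \<phi>. C2_defining_function S U \<phi> \<longrightarrow>
     (\<forall>g \<in> S \<inter> U. H_mean_curvature \<phi> g = 0))"

definition entire_graph :: "heis set \<Rightarrow> bool" where
  "entire_graph S \<longleftrightarrow> C2_surface S \<and>
     (\<exists>a b c \<gamma>. (a, b, c) \<noteq> (0, 0, 0) \<and>
        (\<forall>g0 \<in> {(x, y, t). a * x + b * y + c * t = \<gamma>}.
           \<exists>!p. p \<in> S \<inter> range (\<lambda>s. g0 + s *\<^sub>R (a, b, c))))"

definition vertical_plane :: "heis set \<Rightarrow> bool" where
  "vertical_plane S \<longleftrightarrow> (\<exists>a b \<gamma>. (a, b) \<noteq> (0, 0) \<and> S = {(x, y, t). a * x + b * y = \<gamma>})"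

text \<open>Rotations about the \<open>t\<close>-axis are group automorphisms, so composing left-translations
  and rotations in either order yields the same family of maps.\<close>

definition graphical_strip_with :: "real set \<Rightarrow> (real \<Rightarrow> real) \<Rightarrow> heis set \<Rightarrow> bool" where
  "graphical_strip_with I G S \<longleftrightarrow> C2_surface S \<and>
     I \<noteq> {} \<and> open I \<and> is_interval I \<and> C2_on G I \<and> (\<forall>t\<in>I. deriv G t \<ge> 0) \<and>
     (\<exists>h \<theta>. (\<lambda>g. rotation_t \<theta> (h \<circ>\<^sub>H g)) ` S = {(x, y, t). t \<in> I \<and> x = y * G t} \<or>
             (\<lambda>g. rotation_t \<theta> (h \<circ>\<^sub>H g)) ` S = {(x, y, t). t \<in> I \<and> y = - x * G t})"

definition graphical_strip :: "heis set \<Rightarrow> bool" where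
  "graphical_strip S \<longleftrightarrow> (\<exists>I G. graphical_strip_with I G S)"

definition strict_graphical_strip :: "heis set \<Rightarrow> bool" where
  "strict_graphical_strip S \<longleftrightarrow> (\<exists>I G. graphical_strip_with I G S \<and>
     (\<exists>J \<subseteq> I. J \<noteq> {} \<and> open J \<and> is_interval J \<and> (\<forall>t\<in>J. deriv G t > 0)))"

end

(* At a non-characteristic point H = 0 says that the horizontal normal is stationary along the
   characteristic direction of S, so S is ruled by horizontal straight segments. S projects
   bijectively onto the plane P, hence homeomorphically by invariance of domain; so S is closed and
   connected, and the segments extend to disjoint complete lines. Their projections along the graph
   direction n are again disjoint lines in P, so all of them are parallel to one plane containing n.
   If n is vertical, the lines have parallel horizontal projections, and moving along a line produces
   a characteristic point. Otherwise the lines parallel to a fixed non-vertical plane are exactly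
   those meeting a fixed vertical axis, and after a left translation S is a union of lines
   {x = y G(t)}, one for each height t. Non-characteristicity at all distances y from the axis reads
   1 + y^2 G' / 2 > 0, so G' >= 0. If G' vanished everywhere, S would be a vertical plane. *)

theory Submission imports Defs
begin

subsection \<open>Functions of class C1 and the implicit function theorem\<close>

text \<open>The horizontal normal is only C1, and its stationarity is known only at points of S.
  Straightness is therefore proved by comparison: S near g is described by its displacement
  \<open>\<delta>\<close> from the candidate horizontal line, and \<open>\<delta>\<close> together
  with the turning \<open>\<sigma>\<close> of the normal solves a homogeneous linear system with
  zero initial values.

  The axis arises as follows. The horizontal plane over (x, y) has normal (y/2, - x/2, 1). A plane
  with normal (y0/2, - x0/2, 1) shares with it exactly the directions (a, b) with a (y - y0) = b (x
  - x0), that is, those pointing at (x0, y0). A suitable plane is found at a point of S whose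
  horizontal plane contains n: the line of S there cannot run along n, since such a line meets S
  only once.

  At the end, vanishing of \<open>G'\<close> only says that the direction of the lines is locally
  constant in the height. Connectedness of the set of heights makes it globally constant, which puts
  S inside a vertical plane; the graph property then excludes a proper subset.\<close>

lemma C1_on_has_derivative:
  assumes "C1_on f U" "x \<in> U"
  shows "(f has_derivative frechet_derivative f (at x)) (at x)"
  using assms by (simp add: C1_on_def frechet_derivative_works)

lemma C2_on_imp_C1_on:
  assumes "C2_on f U" "open U"
  shows "C1_on f U"
proof -
  have "continuous_on U (\<lambda>x. frechet_derivative f (at x) v)" for v
    using assms unfolding C2_on_def C1_on_def
    by (meson continuous_at_imp_continuous_on differentiable_imp_continuous_within)
  then show ?thesis
    using assms by (auto simp: C1_on_def C2_on_def)
qed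

lemma C1_on_subset: "C1_on f U \<Longrightarrow> V \<subseteq> U \<Longrightarrow> C1_on f V"
  unfolding C1_on_def by (meson continuous_on_subset subsetD)

lemma C1_on_isCont_derivative:
  assumes "C1_on f U" "open U" "x \<in> U"
  shows "isCont (\<lambda>x. frechet_derivative f (at x) v) x"
  using assms unfolding C1_on_def by (metis continuous_on_eq_continuous_at)

text \<open>By the mean value theorem \<open>\<phi>\<close> is injective along \<open>w\<close> in a
  small ball, so \<open>F\<close> is injective and, by invariance of domain, has open image. Letting
  \<open>y\<close> range over a full ball instead of a hyperplane avoids choosing a complement of
  \<open>w\<close>.\<close>

lemma C1_implicit_function:
  fixes \<phi> :: "'a::euclidean_space \<Rightarrow> real"
  assumes "C1_on \<phi> U" "open U" "g \<in> U" "\<phi> g = 0" "frechet_derivative \<phi> (at g) w \<noteq> 0"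
  obtains \<epsilon> \<delta> where "\<epsilon> > 0" "\<delta> g = 0"
    "\<And>y. y \<in> ball g \<epsilon> \<Longrightarrow> y + \<delta> y *\<^sub>R w \<in> U \<and> \<phi> (y + \<delta> y *\<^sub>R w) = 0 \<and>
       frechet_derivative \<phi> (at (y + \<delta> y *\<^sub>R w)) w \<noteq> 0"
    "\<And>y. y \<in> ball g \<epsilon> \<Longrightarrow> (\<delta> has_derivative
       (\<lambda>v. - frechet_derivative \<phi> (at (y + \<delta> y *\<^sub>R w)) v /
              frechet_derivative \<phi> (at (y + \<delta> y *\<^sub>R w)) w)) (at y)"
proof -
  let ?D = "\<lambda>x. frechet_derivative \<phi> (at x)"
  have "isCont (\<lambda>x. ?D x w) g"
    using assms C1_on_isCont_derivative by blast
  then have "eventually (\<lambda>x. ?D x w \<noteq> 0) (nhds g)"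
    using assms(5) by (simp add: isCont_def continuous_at tendsto_imp_eventually_ne
        eventually_nhds_conv_at)
  moreover have "eventually (\<lambda>x. x \<in> U) (nhds g)"
    using assms eventually_nhds_in_open by blast
  ultimately have "eventually (\<lambda>x. ?D x w \<noteq> 0 \<and> x \<in> U) (nhds g)"
    by (rule eventually_conj)
  then obtain r where r: "r > 0" "\<And>x. x \<in> ball g r \<Longrightarrow> ?D x w \<noteq> 0 \<and> x \<in> U"
    by (auto simp: eventually_nhds_metric dist_commute)
  define B where "B = ball g r"
  have BD: "(\<phi> has_derivative ?D x) (at x)" if "x \<in> B" for x
    using r that assms(1) C1_on_has_derivative B_def by blast
  define D where "D = {z :: 'a \<times> real. fst z + snd z *\<^sub>R w \<in> B}"
  define F where "F = (\<lambda>z :: 'a \<times> real. (fst z, \<phi> (fst z + snd z *\<^sub>R w)))"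
  have "D = (\<lambda>z. fst z + snd z *\<^sub>R w) -` B"
    by (auto simp: D_def)
  moreover have "continuous_on UNIV (\<lambda>z :: 'a \<times> real. fst z + snd z *\<^sub>R w)"
    by (intro continuous_intros)
  ultimately have "open D"
    by (simp add: B_def open_vimage)
  have derF: "(F has_derivative (\<lambda>h. (fst h, ?D (fst z + snd z *\<^sub>R w) (fst h + snd h *\<^sub>R w)))) (at z)"
    if "z \<in> D" for z
  proof -
    have "((\<lambda>z :: 'a \<times> real. fst z + snd z *\<^sub>R w) has_derivative (\<lambda>h. fst h + snd h *\<^sub>R w)) (at z)"
      by (auto intro!: derivative_eq_intros)
    from has_derivative_compose[OF this, of \<phi>] BD that
    have "((\<lambda>z. \<phi> (fst z + snd z *\<^sub>R w)) has_derivative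
        (\<lambda>h. ?D (fst z + snd z *\<^sub>R w) (fst h + snd h *\<^sub>R w))) (at z)"
      by (simp add: D_def)
    then show ?thesis
      unfolding F_def by (auto intro!: derivative_eq_intros)
  qed
  have contF: "continuous_on D F"
    using derF has_derivative_continuous continuous_at_imp_continuous_on by blast
  have mono: "a = b" if a: "y + a *\<^sub>R w \<in> B" and b: "y + b *\<^sub>R w \<in> B"
    and eq: "\<phi> (y + a *\<^sub>R w) = \<phi> (y + b *\<^sub>R w)" and "a \<le> b" for y and a b :: real
  proof (rule ccontr)
    assume "a \<noteq> b"
    with \<open>a \<le> b\<close> have "a < b" by simp
    have inB: "y + s *\<^sub>R w \<in> B" if "a \<le> s" "s \<le> b" for s
    proof -
      define u where "u = (s - a) / (b - a)"
      have u: "0 \<le> u" "u \<le> 1" using that \<open>a < b\<close> by (auto simp: u_def)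
      have s: "s = (1 - u) * a + u * b"
      proof -
        have "u * (b - a) = s - a" using \<open>a < b\<close> by (simp add: u_def)
        then show ?thesis by (simp add: algebra_simps)
      qed
      have "y + s *\<^sub>R w = (1 - u) *\<^sub>R (y + a *\<^sub>R w) + u *\<^sub>R (y + b *\<^sub>R w)"
        unfolding s by (simp add: algebra_simps)
      moreover have "convex B" by (simp add: B_def)
      ultimately show ?thesis using a b u by (simp add: convex_def)
    qed
    have der: "((\<lambda>s. \<phi> (y + s *\<^sub>R w)) has_real_derivative ?D (y + s *\<^sub>R w) w) (at s)"
      if "a \<le> s" "s \<le> b" for s
    proof -
      have "((\<lambda>s. y + s *\<^sub>R w) has_derivative (\<lambda>h. h *\<^sub>R w)) (at s)"
        by (auto intro!: derivative_eq_intros)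
      from has_derivative_compose[OF this BD[OF inB[OF that]]]
      have "((\<lambda>s. \<phi> (y + s *\<^sub>R w)) has_derivative (\<lambda>h. ?D (y + s *\<^sub>R w) (h *\<^sub>R w))) (at s)" .
      moreover have "?D (y + s *\<^sub>R w) (h *\<^sub>R w) = ?D (y + s *\<^sub>R w) w * h" for h
        using has_derivative_linear[OF BD[OF inB[OF that]]] by (simp add: linear_cmul)
      ultimately show ?thesis
        by (simp add: has_field_derivative_def)
    qed
    obtain s where "a < s" "s < b" "\<phi> (y + b *\<^sub>R w) - \<phi> (y + a *\<^sub>R w) = (b - a) * ?D (y + s *\<^sub>R w) w"
      using MVT2[OF \<open>a < b\<close> der] by blast
    then show False
      using eq \<open>a < b\<close> r inB[of s] by (auto simp: B_def)
  qed
  have "inj_on F D"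
  proof (rule inj_onI)
    fix z z' assume z: "z \<in> D" "z' \<in> D" and eq: "F z = F z'"
    have 1: "fst z = fst z'" using eq by (simp add: F_def)
    moreover have "snd z = snd z'"
      using mono[of "fst z" "snd z" "snd z'"] mono[of "fst z" "snd z'" "snd z"] z eq 1
        linear[of "snd z" "snd z'"]
      by (auto simp: F_def D_def)
    ultimately show "z = z'" by (simp add: prod_eq_iff)
  qed
  then have "open (F ` D)"
    using invariance_of_domain contF \<open>open D\<close> by blast
  have gD: "(g, 0) \<in> D" using r by (simp add: D_def B_def)
  moreover have Fg: "F (g, 0) = (g, 0)" using assms by (simp add: F_def)
  ultimately have "(g, 0) \<in> F ` D" by (metis image_eqI)
  then obtain \<epsilon> where \<epsilon>: "\<epsilon> > 0" "ball (g, 0) \<epsilon> \<subseteq> F ` D"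
    using \<open>open (F ` D)\<close> open_contains_ball by blast
  define G where "G = inv_into D F"
  have GF: "G (F z) = z" if "z \<in> D" for z
    unfolding G_def using \<open>inj_on F D\<close> that by simp
  define \<delta> where "\<delta> = (\<lambda>y. snd (G (y, 0)))"
  have y: "(y, \<delta> y) \<in> D \<and> F (y, \<delta> y) = (y, 0) \<and> G (y, 0) = (y, \<delta> y)" if "y \<in> ball g \<epsilon>" for y
  proof -
    have "(y, 0::real) \<in> ball (g, 0) \<epsilon>"
      using that by (simp add: dist_prod_def)
    then obtain z where z: "z \<in> D" "F z = (y, 0)" using \<epsilon> by force
    moreover have "fst z = y" using z by (simp add: F_def)
    ultimately show ?thesis
      using GF[of z] by (metis \<delta>_def prod.collapse)
  qed
  show thesis
  proof
    show "\<epsilon> > 0" by fact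
    show "\<delta> g = 0" using GF[OF gD] Fg by (simp add: \<delta>_def)
    fix y assume yb: "y \<in> ball g \<epsilon>"
    let ?q = "y + \<delta> y *\<^sub>R w"
    have q: "?q \<in> B" using y[OF yb] by (simp add: D_def)
    then show "?q \<in> U \<and> \<phi> ?q = 0 \<and> ?D ?q w \<noteq> 0"
      using y[OF yb] r by (auto simp: B_def F_def)
    then have nz: "?D ?q w \<noteq> 0" by blast
    have lin: "linear (?D ?q)" using BD[OF q] has_derivative_linear by blast
    \<comment> \<open>The derivative of \<open>F\<close> is triangular; this is its inverse.\<close>
    define g' where "g' = (\<lambda>h :: 'a \<times> real. (fst h, (snd h - ?D ?q (fst h)) / ?D ?q w))"
    have "(G has_derivative g') (at (F (y, \<delta> y)))"
    proof (rule has_derivative_inverse_strong[where f=F and x="(y, \<delta> y)" and S=D])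
      show "open D" "(y, \<delta> y) \<in> D" "continuous_on D F" using \<open>open D\<close> y[OF yb] contF by auto
      show "\<And>x. x \<in> D \<Longrightarrow> G (F x) = x" by (rule GF)
      show "(F has_derivative (\<lambda>h. (fst h, ?D ?q (fst h + snd h *\<^sub>R w)))) (at (y, \<delta> y))"
        using derF[of "(y, \<delta> y)"] y[OF yb] by simp
      show "(\<lambda>h. (fst h, ?D ?q (fst h + snd h *\<^sub>R w))) \<circ> g' = id"
        using nz lin by (auto simp: g'_def fun_eq_iff linear_add linear_cmul)
    qed
    then have "(G has_derivative g') (at (y, 0))" using y[OF yb] by simp
    moreover have "((\<lambda>y. (y, 0::real)) has_derivative (\<lambda>v. (v, 0))) (at y)"
      by (auto intro!: derivative_eq_intros)
    ultimately have "((\<lambda>y. G (y, 0)) has_derivative (\<lambda>v. g' (v, 0))) (at y)"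
      using has_derivative_compose by fastforce
    then have "(\<delta> has_derivative (\<lambda>v. snd (g' (v, 0)))) (at y)"
      unfolding \<delta>_def by (rule has_derivative_snd)
    then show "(\<delta> has_derivative (\<lambda>v. - ?D ?q v / ?D ?q w)) (at y)"
      by (simp add: g'_def)
  qed
qed

text \<open>The form used for curves: follow \<open>v\<close> and correct along a transversal
  \<open>w\<close> so as to stay on the surface.\<close>

lemma C1_implicit_curve:
  fixes \<phi> :: "'a::euclidean_space \<Rightarrow> real"
  assumes "C1_on \<phi> U" "open U" "g \<in> U" "\<phi> g = 0" "frechet_derivative \<phi> (at g) w \<noteq> 0"
  obtains r \<delta> where "r > 0" "\<delta> 0 = 0"
    "\<forall>s. \<bar>s\<bar> < r \<longrightarrow> g + s *\<^sub>R v + \<delta> s *\<^sub>R w \<in> U \<and> \<phi> (g + s *\<^sub>R v + \<delta> s *\<^sub>R w) = 0 \<and>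
       frechet_derivative \<phi> (at (g + s *\<^sub>R v + \<delta> s *\<^sub>R w)) w \<noteq> 0"
    "\<forall>s. \<bar>s\<bar> < r \<longrightarrow> (\<delta> has_real_derivative
       - frechet_derivative \<phi> (at (g + s *\<^sub>R v + \<delta> s *\<^sub>R w)) v /
         frechet_derivative \<phi> (at (g + s *\<^sub>R v + \<delta> s *\<^sub>R w)) w) (at s)"
proof -
  let ?D = "\<lambda>p. frechet_derivative \<phi> (at p)"
  obtain \<epsilon> \<delta> where \<delta>: "\<epsilon> > 0" "\<delta> g = 0"
    "\<And>y. y \<in> ball g \<epsilon> \<Longrightarrow> y + \<delta> y *\<^sub>R w \<in> U \<and> \<phi> (y + \<delta> y *\<^sub>R w) = 0 \<and> ?D (y + \<delta> y *\<^sub>R w) w \<noteq> 0"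
    "\<And>y. y \<in> ball g \<epsilon> \<Longrightarrow> (\<delta> has_derivative
       (\<lambda>v. - ?D (y + \<delta> y *\<^sub>R w) v / ?D (y + \<delta> y *\<^sub>R w) w)) (at y)"
    using C1_implicit_function[OF assms] by blast
  define r where "r = \<epsilon> / (norm v + 1)"
  have r: "r > 0" using \<delta>(1) by (simp add: r_def add_nonneg_pos)
  have ball: "g + s *\<^sub>R v \<in> ball g \<epsilon>" if "\<bar>s\<bar> < r" for s
  proof -
    have "\<bar>s\<bar> * norm v \<le> \<bar>s\<bar> * (norm v + 1)" by (simp add: algebra_simps)
    also have "\<dots> < r * (norm v + 1)"
      using that by (intro mult_strict_right_mono) (auto simp: add_nonneg_pos)
    also have "\<dots> = \<epsilon>" unfolding r_def by (smt (verit) norm_ge_zero nonzero_eq_divide_eq)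
    finally show ?thesis by (simp add: dist_norm)
  qed
  define d where "d = (\<lambda>s. \<delta> (g + s *\<^sub>R v))"
  let ?q = "\<lambda>s. g + s *\<^sub>R v + d s *\<^sub>R w"
  have der: "(d has_real_derivative - ?D (?q s) v / ?D (?q s) w) (at s)" if s: "\<bar>s\<bar> < r" for s
  proof -
    have lin: "linear (?D (?q s))"
      using C1_on_has_derivative[OF assms(1)] \<delta>(3)[OF ball[OF s]] has_derivative_linear
      by (force simp: d_def)
    have "((\<lambda>s. g + s *\<^sub>R v) has_derivative (\<lambda>h. h *\<^sub>R v)) (at s)"
      by (auto intro!: derivative_eq_intros)
    from has_derivative_compose[OF this \<delta>(4)[OF ball[OF s]]]
    have "(d has_derivative (\<lambda>h. - ?D (?q s) (h *\<^sub>R v) / ?D (?q s) w)) (at s)"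
      by (simp add: d_def)
    moreover have "- ?D (?q s) (h *\<^sub>R v) / ?D (?q s) w = - ?D (?q s) v / ?D (?q s) w * h" for h
      using lin by (simp add: linear_cmul)
    ultimately have "(d has_derivative (\<lambda>h. - ?D (?q s) v / ?D (?q s) w * h)) (at s)"
      by (simp only:)
    then show ?thesis unfolding has_field_derivative_def .
  qed
  show thesis
    by (rule that[OF r, of d]) (use \<delta> ball der in \<open>auto simp: d_def\<close>)
qed

text \<open>Apply the mean value theorem to \<open>E s * exp (- K * s)\<close>.\<close>

lemma gronwall_zero_right:
  fixes E :: "real \<Rightarrow> real"
  assumes der: "\<And>s. 0 \<le> s \<Longrightarrow> s < \<epsilon> \<Longrightarrow> (E has_real_derivative E' s) (at s)"
    and le: "\<And>s. 0 \<le> s \<Longrightarrow> s < \<epsilon> \<Longrightarrow> E' s \<le> K * E s"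
    and nonneg: "\<And>s. E s \<ge> 0" and "E 0 = 0" and s: "0 \<le> s" "s < \<epsilon>"
  shows "E s = 0"
proof -
  have "E s * exp (- K * s) \<le> E 0 * exp (- K * 0)"
  proof (rule DERIV_nonpos_imp_nonincreasing[OF s(1)])
    fix x assume x: "0 \<le> x" "x \<le> s"
    have "((\<lambda>s. E s * exp (- K * s)) has_real_derivative (E' x - K * E x) * exp (- K * x)) (at x)"
      using x s by (auto intro!: derivative_eq_intros der simp: algebra_simps)
    moreover have "(E' x - K * E x) * exp (- K * x) \<le> 0"
      using le[of x] x s by (simp add: mult_nonpos_nonneg)
    ultimately show "\<exists>y. ((\<lambda>s. E s * exp (- K * s)) has_real_derivative y) (at x) \<and> y \<le> 0"
      by blast
  qed
  then have "E s \<le> 0" using \<open>E 0 = 0\<close> by (simp add: mult_le_0_iff)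
  then show ?thesis using nonneg[of s] by simp
qed

text \<open>The bound is on \<open>\<bar>E' s\<bar>\<close> because negative parameters are handled
  by reflection, which changes the sign of the derivative.\<close>

lemma gronwall_zero:
  fixes E :: "real \<Rightarrow> real"
  assumes der: "\<And>s. \<bar>s\<bar> < \<epsilon> \<Longrightarrow> (E has_real_derivative E' s) (at s)"
    and le: "\<And>s. \<bar>s\<bar> < \<epsilon> \<Longrightarrow> \<bar>E' s\<bar> \<le> K * E s"
    and nonneg: "\<And>s. E s \<ge> 0" and "E 0 = 0" and s: "\<bar>s\<bar> < \<epsilon>"
  shows "E s = 0"
proof (cases "s \<ge> 0")
  case True
  show ?thesis
    by (rule gronwall_zero_right[where \<epsilon>=\<epsilon> and K=K and E'=E'])
      (use assms True in \<open>auto simp: abs_le_iff\<close>)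
next
  case False
  have "E (- (- s)) = 0"
  proof (rule gronwall_zero_right[where \<epsilon>=\<epsilon> and K=K and E="\<lambda>s. E (- s)" and E'="\<lambda>s. - E' (- s)"])
    fix x assume x: "0 \<le> x" "x < \<epsilon>"
    show "((\<lambda>s. E (- s)) has_real_derivative - E' (- x)) (at x)"
    proof -
      have "(E has_real_derivative E' (- x)) (at (- x))" using x by (intro der) auto
      then have "((\<lambda>s. E (- s)) has_real_derivative E' (- x) * (- 1)) (at x)"
        by (rule DERIV_chain2) (auto intro!: derivative_eq_intros)
      then show ?thesis by simp
    qed
    show "- E' (- x) \<le> K * E (- x)" using le[of "- x"] x by auto
  qed (use assms False in auto)
  then show ?thesis by simp
qed

section \<open>Calculus rules for functions of class C1 and C2\<close>

lemma C1_onI: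
  assumes "open U" "\<And>x. x \<in> U \<Longrightarrow> (f has_derivative f' x) (at x)"
    "\<And>v. continuous_on U (\<lambda>x. f' x v)"
  shows "C1_on f U"
proof -
  have "frechet_derivative f (at x) = f' x" if "x \<in> U" for x
    using assms(2)[OF that] frechet_derivative_at by metis
  moreover have "f differentiable (at x)" if "x \<in> U" for x
    using assms(2)[OF that] differentiable_def by blast
  moreover have "continuous_on U (\<lambda>x. frechet_derivative f (at x) v)" for v
    using assms(3)[of v] calculation(1) by (simp cong: continuous_on_cong)
  ultimately show ?thesis
    unfolding C1_on_def by blast
qed

lemma C1_on_continuous_on: "C1_on f U \<Longrightarrow> continuous_on U f"
  by (meson C1_on_def continuous_at_imp_continuous_on differentiable_imp_continuous_within)

lemma C1_on_cong:
  assumes "C1_on f U" "open U" "\<And>x. x \<in> U \<Longrightarrow> f x = g x"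
  shows "C1_on g U"
proof (rule C1_onI[OF assms(2)])
  fix x assume "x \<in> U"
  then show "(g has_derivative frechet_derivative f (at x)) (at x)"
    using has_derivative_transform_within_open[OF C1_on_has_derivative[OF assms(1)]] assms by blast
next
  show "continuous_on U (\<lambda>x. frechet_derivative f (at x) v)" for v
    using assms by (auto simp: C1_on_def)
qed

lemma C1_on_diff:
  assumes "C1_on f U" "C1_on g U" "open U"
  shows "C1_on (\<lambda>x. f x - g x) U"
proof (rule C1_onI[OF assms(3)])
  fix x assume "x \<in> U"
  then show "((\<lambda>x. f x - g x) has_derivative
      (\<lambda>v. frechet_derivative f (at x) v - frechet_derivative g (at x) v)) (at x)"
    using assms by (intro has_derivative_diff C1_on_has_derivative)
next
  show "continuous_on U (\<lambda>x. frechet_derivative f (at x) v - frechet_derivative g (at x) v)" for v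
    using assms by (intro continuous_intros) (auto simp: C1_on_def)
qed

lemma C1_on_mult:
  assumes "C1_on f U" "C1_on g U" "open U"
  shows "C1_on (\<lambda>x. f x * g x) U"
proof (rule C1_onI[OF assms(3)])
  fix x assume "x \<in> U"
  then show "((\<lambda>x. f x * g x) has_derivative
      (\<lambda>v. f x * frechet_derivative g (at x) v + frechet_derivative f (at x) v * g x)) (at x)"
    using assms by (intro has_derivative_mult C1_on_has_derivative)
next
  fix v
  have "continuous_on U (\<lambda>x. frechet_derivative f (at x) v)"
    "continuous_on U (\<lambda>x. frechet_derivative g (at x) v)"
    using assms by (auto simp: C1_on_def)
  then show "continuous_on U (\<lambda>x. f x * frechet_derivative g (at x) v + frechet_derivative f (at x) v * g x)"
    using C1_on_continuous_on[OF assms(1)] C1_on_continuous_on[OF assms(2)]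
    by (intro continuous_on_add continuous_on_mult)
qed

lemma C1_on_bounded_linear:
  assumes "bounded_linear f" "open U"
  shows "C1_on f U"
  using assms by (intro C1_onI[where f'="\<lambda>x. f"]) (auto intro: bounded_linear_imp_has_derivative)

text \<open>\<open>C1_on\<close> controls the differential only in a fixed direction; expanding
  \<open>X t\<close> in the basis handles a direction that varies.\<close>

lemma continuous_on_frechet_derivative_apply:
  fixes f :: "'a::euclidean_space \<Rightarrow> real"
  assumes f: "C1_on f U" and \<gamma>: "continuous_on I \<gamma>" "\<gamma> ` I \<subseteq> U" and X: "continuous_on I X"
  shows "continuous_on I (\<lambda>t. frechet_derivative f (at (\<gamma> t)) (X t))"
proof -
  let ?D = "\<lambda>p. frechet_derivative f (at p)"
  have "continuous_on I (\<lambda>t. ?D (\<gamma> t) i)" for i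
    using continuous_on_compose2[OF _ \<gamma>] f unfolding C1_on_def by blast
  then have "continuous_on I (\<lambda>t. \<Sum>i\<in>Basis. (X t \<bullet> i) * ?D (\<gamma> t) i)"
    by (intro continuous_intros X)
  moreover have "(\<Sum>i\<in>Basis. (X t \<bullet> i) * ?D (\<gamma> t) i) = ?D (\<gamma> t) (X t)" if "t \<in> I" for t
  proof -
    have lin: "linear (?D (\<gamma> t))"
      using C1_on_has_derivative[OF f] \<gamma>(2) that has_derivative_linear by blast
    have "?D (\<gamma> t) (X t) = ?D (\<gamma> t) (\<Sum>i\<in>Basis. (X t \<bullet> i) *\<^sub>R i)"
      by (simp add: euclidean_representation)
    also have "\<dots> = (\<Sum>i\<in>Basis. (X t \<bullet> i) * ?D (\<gamma> t) i)"
      by (simp only: linear_sum[OF lin] linear_cmul[OF lin] real_scaleR_def)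
    finally show ?thesis by simp
  qed
  ultimately show ?thesis by (simp cong: continuous_on_cong)
qed

lemma C1_on_compose_curve:
  fixes f :: "'a::euclidean_space \<Rightarrow> real" and \<gamma> :: "real \<Rightarrow> 'a"
  assumes f: "C1_on f U" and "open I" and U: "\<And>t. t \<in> I \<Longrightarrow> \<gamma> t \<in> U"
    and \<gamma>: "\<And>t. t \<in> I \<Longrightarrow> (\<gamma> has_vector_derivative \<gamma>' t) (at t)" and \<gamma>': "continuous_on I \<gamma>'"
  shows "C1_on (\<lambda>t. f (\<gamma> t)) I"
proof (rule C1_onI[OF \<open>open I\<close>])
  fix t assume t: "t \<in> I"
  show "((\<lambda>t. f (\<gamma> t)) has_derivative (\<lambda>h. frechet_derivative f (at (\<gamma> t)) (h *\<^sub>R \<gamma>' t))) (at t)"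
    using has_derivative_compose[OF \<gamma>[OF t, unfolded has_vector_derivative_def]
        C1_on_has_derivative[OF f U[OF t]]] .
next
  have "continuous_on I \<gamma>"
    using \<gamma> by (meson continuous_at_imp_continuous_on has_vector_derivative_continuous)
  then show "continuous_on I (\<lambda>t. frechet_derivative f (at (\<gamma> t)) (v *\<^sub>R \<gamma>' t))" for v
    using U by (intro continuous_on_frechet_derivative_apply[OF f] continuous_intros \<gamma>') auto
qed

lemma C1_on_const: "open U \<Longrightarrow> C1_on (\<lambda>x. c) U"
  by (rule C1_onI[where f'="\<lambda>x v. 0"]) auto

lemma C1_on_divide:
  assumes f: "C1_on f U" and g: "C1_on g U" and "open U" and nz: "\<And>x. x \<in> U \<Longrightarrow> g x \<noteq> 0"
  shows "C1_on (\<lambda>x. f x / g x) U"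
proof (rule C1_onI[OF \<open>open U\<close>])
  fix x assume "x \<in> U"
  then show "((\<lambda>x. f x / g x) has_derivative
      (\<lambda>v. (frechet_derivative f (at x) v * g x - f x * frechet_derivative g (at x) v) / (g x * g x))) (at x)"
    using nz by (intro has_derivative_divide' C1_on_has_derivative[OF f] C1_on_has_derivative[OF g])
next
  fix v
  have "continuous_on U (\<lambda>x. frechet_derivative f (at x) v)"
    "continuous_on U (\<lambda>x. frechet_derivative g (at x) v)"
    using f g by (auto simp: C1_on_def)
  then show "continuous_on U (\<lambda>x. (frechet_derivative f (at x) v * g x - f x * frechet_derivative g (at x) v) / (g x * g x))"
    using C1_on_continuous_on[OF f] C1_on_continuous_on[OF g] nz
    by (intro continuous_on_divide continuous_on_diff continuous_on_mult) auto
qed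

lemma C2_onI_real:
  fixes G :: "real \<Rightarrow> real"
  assumes "open I" and G: "\<And>t. t \<in> I \<Longrightarrow> (G has_real_derivative G' t) (at t)" and G': "C1_on G' I"
  shows "C2_on G I"
proof -
  have "frechet_derivative G (at t) v = G' t * v" if "t \<in> I" for t v
    using frechet_derivative_at[OF G[OF that, unfolded has_field_derivative_def]] by metis
  then have "C1_on (\<lambda>t. frechet_derivative G (at t) v) I" for v
    by (intro C1_on_cong[OF C1_on_mult[OF G' C1_on_const[OF \<open>open I\<close>, of v] \<open>open I\<close>] \<open>open I\<close>]) simp
  moreover have "G differentiable (at t)" if "t \<in> I" for t
    using G[OF that] by (auto simp: differentiable_def has_field_derivative_def)
  ultimately show ?thesis by (simp add: C2_on_def)
qed

lemma C2_on_subset: "C2_on f U \<Longrightarrow> V \<subseteq> U \<Longrightarrow> C2_on f V"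
  unfolding C2_on_def by (meson C1_on_subset subsetD)

subsection \<open>Horizontal directions and characteristic points\<close>

definition hor :: "heis \<Rightarrow> real \<Rightarrow> real \<Rightarrow> heis" where
  "hor g a b = a *\<^sub>R X1 g + b *\<^sub>R X2 g"

lemma hor_Pair: "hor (x, y, t) a b = (a, b, (x * b - y * a) / 2)"
  by (simp add: hor_def X1_def X2_def field_simps)

text \<open>The vertical coefficient is half the planar determinant of (x, y) with (a, b), which
  does not change when (x, y) moves along (a, b). Hence the integral curves of
  \<open>a X1 + b X2\<close> are Euclidean straight lines.\<close>

lemma hor_along_line: "hor (g + s *\<^sub>R hor g a b) a b = hor g a b"
  by (cases g) (simp add: hor_Pair field_simps)

lemma hor_scale: "hor g (c * a) (c * b) = c *\<^sub>R hor g a b"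
  by (simp add: hor_def algebra_simps)

lemma linear_hor:
  assumes "linear f"
  shows "f (hor g a b) = a * f (X1 g) + b * f (X2 g)"
  using assms by (simp add: hor_def linear_add linear_cmul)

lemma defining_functionD:
  assumes "C2_defining_function S U \<phi>"
  shows "open U" "C1_on \<phi> U" "\<And>v. C1_on (\<lambda>p. frechet_derivative \<phi> (at p) v) U"
    "\<And>p. p \<in> U \<Longrightarrow> p \<in> S \<longleftrightarrow> \<phi> p = 0"
    "\<And>p. p \<in> U \<Longrightarrow> (\<phi> has_derivative frechet_derivative \<phi> (at p)) (at p)"
    "\<And>p. p \<in> U \<Longrightarrow> linear (frechet_derivative \<phi> (at p))"
proof -
  show U: "open U" using assms by (simp add: C2_defining_function_def)
  show c: "C1_on \<phi> U" using assms U C2_on_imp_C1_on by (auto simp: C2_defining_function_def)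
  show "C1_on (\<lambda>p. frechet_derivative \<phi> (at p) v) U" for v
    using assms unfolding C2_defining_function_def C2_on_def by blast
  show "p \<in> S \<longleftrightarrow> \<phi> p = 0" if "p \<in> U" for p
    using assms that by (auto simp: C2_defining_function_def)
  show d: "(\<phi> has_derivative frechet_derivative \<phi> (at p)) (at p)" if "p \<in> U" for p
    using C1_on_has_derivative c that by blast
  show "linear (frechet_derivative \<phi> (at p))" if "p \<in> U" for p
    using d[OF that] has_derivative_linear by blast
qed

text \<open>A nonzero derivative of \<open>\<phi>\<close> along the curve would keep all nearby
  points of the curve off S. Returning to S frequently is thus enough, which is what limit points of
  segments provide later.\<close>

lemma defining_function_derivative_zero:
  assumes S: "C2_defining_function S U \<phi>" and U: "\<gamma> s \<in> U" "\<gamma> s \<in> S"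
    and der: "(\<gamma> has_vector_derivative v) (at s)"
    and freq: "frequently (\<lambda>s. \<gamma> s \<in> S) (at s)"
  shows "frechet_derivative \<phi> (at (\<gamma> s)) v = 0"
proof (rule ccontr)
  let ?D = "frechet_derivative \<phi> (at (\<gamma> s))"
  assume nz: "?D v \<noteq> 0"
  have lin: "linear ?D" using defining_functionD[OF S] U by blast
  have "((\<lambda>s. \<phi> (\<gamma> s)) has_derivative (\<lambda>h. ?D (h *\<^sub>R v))) (at s)"
    using has_derivative_compose[OF der[unfolded has_vector_derivative_def]]
      defining_functionD(5)[OF S U(1)] by blast
  moreover have "?D (h *\<^sub>R v) = ?D v * h" for h using lin by (simp add: linear_cmul)
  ultimately have "((\<lambda>s. \<phi> (\<gamma> s)) has_real_derivative ?D v) (at s)"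
    by (simp add: has_field_derivative_def)
  then have "((\<lambda>y. (\<phi> (\<gamma> y) - \<phi> (\<gamma> s)) / (y - s)) \<longlongrightarrow> ?D v) (at s)"
    by (simp add: has_field_derivative_iff)
  then have 1: "eventually (\<lambda>y. (\<phi> (\<gamma> y) - \<phi> (\<gamma> s)) / (y - s) \<noteq> 0) (at s)"
    using nz tendsto_imp_eventually_ne by blast
  have "isCont \<gamma> s" using der has_vector_derivative_continuous by blast
  then have 2: "eventually (\<lambda>y. \<gamma> y \<in> U) (at s)"
    using defining_functionD(1)[OF S] U(1) by (auto simp: isCont_def dest: topological_tendstoD)
  have "eventually (\<lambda>y. \<gamma> y \<notin> S) (at s)"
    using 1 2 by eventually_elim (use defining_functionD(4)[OF S] U in auto)
  then show False using freq by (simp add: frequently_def)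
qed

lemma heis_decompose: "v = hor g (fst v) (fst (snd v)) + (snd (snd v) - snd (snd (hor g (fst v) (fst (snd v))))) *\<^sub>R (0, 0, 1)"
  by (cases g; cases v) (simp add: hor_Pair)

text \<open>If both derivatives vanished, the kernel of the nonzero differential would be exactly
  the horizontal plane. As tangent vectors are velocities of C1 curves in S, each horizontal vector
  must then be realized by such a curve; the implicit curve corrected along \<open>?T\<close> does
  this.\<close>

lemma noncharacteristic_point:
  assumes S: "C2_defining_function S U \<phi>" and g: "g \<in> U" "g \<in> S"
    and nc: "characteristic_locus S = {}"
  shows "vf_apply X1 \<phi> g \<noteq> 0 \<or> vf_apply X2 \<phi> g \<noteq> 0"
proof (rule ccontr)
  let ?D = "\<lambda>p. frechet_derivative \<phi> (at p)"
  let ?T = "(0, 0, 1) :: heis"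
  assume "\<not> ?thesis"
  then have 0: "?D g (X1 g) = 0" "?D g (X2 g) = 0" by (auto simp: vf_apply_def)
  note D = defining_functionD[OF S]
  have lin: "linear (?D g)" using D(6) g by blast
  have hor0: "?D g (hor g a b) = 0" for a b
    using linear_hor[OF lin] 0 by simp
  let ?c = "\<lambda>v. snd (snd v) - snd (snd (hor g (fst v) (fst (snd v))))"
  have dec: "?D g v = ?c v * ?D g ?T" for v
  proof -
    have "?D g v = ?D g (hor g (fst v) (fst (snd v)) + ?c v *\<^sub>R ?T)"
      using heis_decompose[of v g] by simp
    also have "\<dots> = ?D g (hor g (fst v) (fst (snd v))) + ?c v * ?D g ?T"
      by (simp only: linear_add[OF lin] linear_cmul[OF lin] real_scaleR_def)
    finally show ?thesis using hor0 by simp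
  qed
  obtain v where "?D g v \<noteq> 0" using S g by (auto simp: C2_defining_function_def)
  then have T: "?D g ?T \<noteq> 0" using dec[of v] by auto
  have span: "span {X1 g, X2 g} = {hor g a b | a b. True}"
    by (auto simp: span_insert span_singleton hor_def algebra_simps diff_eq_eq)
  have "tangent_space S g = span {X1 g, X2 g}"
  proof (rule set_eqI)
    fix v
    show "v \<in> tangent_space S g \<longleftrightarrow> v \<in> span {X1 g, X2 g}"
    proof
      assume "v \<in> tangent_space S g"
      then obtain \<gamma> \<epsilon> where \<gamma>: "\<epsilon> > 0" "\<gamma> ` {-\<epsilon><..<\<epsilon>} \<subseteq> S" "\<gamma> 0 = g"
        "(\<gamma> has_vector_derivative v) (at 0)" by (auto simp: tangent_space_def)
      have "eventually (\<lambda>s. s \<in> {-\<epsilon><..<\<epsilon>}) (at 0)"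
        using \<gamma>(1) by (intro eventually_at_in_open') auto
      then have "eventually (\<lambda>s. \<gamma> s \<in> S) (at 0)"
        by eventually_elim (use \<gamma> in auto)
      then have "?D g v = 0"
        using defining_function_derivative_zero[OF S, of \<gamma> 0 v] \<gamma> g
        by (simp add: eventually_frequently)
      then have "?c v = 0" using dec[of v] T by simp
      then have "v = hor g (fst v) (fst (snd v))"
        using heis_decompose[of v g] by (metis add.right_neutral scaleR_zero_left)
      then show "v \<in> span {X1 g, X2 g}" unfolding span by blast
    next
      assume "v \<in> span {X1 g, X2 g}"
      then have v: "?D g v = 0" using hor0 by (auto simp: span)
      have \<phi>g: "\<phi> g = 0" using D(4) g by blast
      obtain r \<delta> where r: "r > 0" and \<delta>: "\<delta> 0 = 0"
        "\<forall>s. \<bar>s\<bar> < r \<longrightarrow> g + s *\<^sub>R v + \<delta> s *\<^sub>R ?T \<in> U \<and> \<phi> (g + s *\<^sub>R v + \<delta> s *\<^sub>R ?T) = 0 \<and>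
           ?D (g + s *\<^sub>R v + \<delta> s *\<^sub>R ?T) ?T \<noteq> 0"
        "\<forall>s. \<bar>s\<bar> < r \<longrightarrow> (\<delta> has_real_derivative
           - ?D (g + s *\<^sub>R v + \<delta> s *\<^sub>R ?T) v / ?D (g + s *\<^sub>R v + \<delta> s *\<^sub>R ?T) ?T) (at s)"
        using C1_implicit_curve[OF D(2,1) g(1) \<phi>g T, of v] by blast
      define \<gamma> where "\<gamma> = (\<lambda>s. g + s *\<^sub>R v + \<delta> s *\<^sub>R ?T)"
      define \<gamma>' where "\<gamma>' = (\<lambda>s. v + (- ?D (\<gamma> s) v / ?D (\<gamma> s) ?T) *\<^sub>R ?T)"
      have \<gamma>: "\<gamma> s \<in> U \<and> \<phi> (\<gamma> s) = 0 \<and> ?D (\<gamma> s) ?T \<noteq> 0" if "s \<in> {-r<..<r}" for s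
        using \<delta>(2) that by (auto simp: \<gamma>_def)
      have der: "(\<gamma> has_vector_derivative \<gamma>' s) (at s)" if "s \<in> {-r<..<r}" for s
      proof -
        have "(\<delta> has_vector_derivative (- ?D (\<gamma> s) v / ?D (\<gamma> s) ?T)) (at s)"
          using \<delta>(3)[rule_format, of s] that abs_less_iff[of s r]
          by (auto simp: \<gamma>_def has_real_derivative_iff_has_vector_derivative)
        then have "((\<lambda>s. g + s *\<^sub>R v + \<delta> s *\<^sub>R ?T) has_vector_derivative \<gamma>' s) (at s)"
          unfolding has_vector_derivative_def \<gamma>'_def
          by (auto intro!: derivative_eq_intros simp: algebra_simps)
        then show ?thesis by (simp only: \<gamma>_def)
      qed
      have cont: "continuous_on {-r<..<r} \<gamma>"
        using der by (meson continuous_at_imp_continuous_on has_vector_derivative_continuous)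
      have im: "\<gamma> ` {-r<..<r} \<subseteq> U" using \<gamma> by blast
      have "continuous_on {-r<..<r} (\<lambda>s. ?D (\<gamma> s) u)" for u
        using continuous_on_compose2[OF _ cont im] D(2) unfolding C1_on_def by blast
      then have "continuous_on {-r<..<r} \<gamma>'"
        unfolding \<gamma>'_def using \<gamma> by (intro continuous_intros) auto
      then have "\<gamma> C1_differentiable_on {-r<..<r}"
        using der unfolding C1_differentiable_on_def by blast
      moreover have "\<gamma> ` {-r<..<r} \<subseteq> S"
        using \<gamma> D(4) by blast
      moreover have \<gamma>0: "\<gamma> 0 = g" using \<delta>(1) by (simp add: \<gamma>_def zero_prod_def)
      \<comment> \<open>The correction along \<open>?T\<close> starts with speed
        \<open>- ?D g v / ?D g ?T\<close>, which is 0.\<close>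
      moreover have "(\<gamma> has_vector_derivative v) (at 0)"
        using der[of 0] r v \<gamma>0 by (simp add: \<gamma>'_def flip: zero_prod_def)
      ultimately show "v \<in> tangent_space S g"
        using r unfolding tangent_space_def by blast
    qed
  qed
  then show False using nc g unfolding characteristic_locus_def by blast
qed

subsection \<open>Horizontal segments in minimal surfaces\<close>

lemma C1_on_vf_apply:
  assumes S: "C2_defining_function S U \<phi>"
  shows "C1_on (vf_apply X1 \<phi>) U" "C1_on (vf_apply X2 \<phi>) U"
proof -
  note D = defining_functionD[OF S]
  have lin: "C1_on (\<lambda>p :: heis. fst p / 2) U" "C1_on (\<lambda>p :: heis. fst (snd p) / 2) U"
    "C1_on (\<lambda>p :: heis. - fst p / 2) U"
    by (auto intro!: C1_on_bounded_linear bounded_linear_intros D(1)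
        bounded_linear_compose[OF bounded_linear_divide] bounded_linear_minus)
  have X: "X1 p = (1, 0, 0) - (fst (snd p) / 2) *\<^sub>R (0, 0, 1)"
    "X2 p = (0, 1, 0) - (- fst p / 2) *\<^sub>R (0, 0, 1)" for p
    by (cases p; simp add: X1_def X2_def)+
  show "C1_on (vf_apply X1 \<phi>) U"
  proof (rule C1_on_cong[OF C1_on_diff[OF D(3) C1_on_mult[OF lin(2) D(3)]]])
    fix p assume "p \<in> U"
    then have "linear (frechet_derivative \<phi> (at p))" by (rule D)
    then show "frechet_derivative \<phi> (at p) (1, 0, 0) -
        fst (snd p) / 2 * frechet_derivative \<phi> (at p) (0, 0, 1) = vf_apply X1 \<phi> p"
      unfolding vf_apply_def X by (simp only: linear_diff linear_cmul real_scaleR_def)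
  qed (use D in auto)
  show "C1_on (vf_apply X2 \<phi>) U"
  proof (rule C1_on_cong[OF C1_on_diff[OF D(3) C1_on_mult[OF lin(3) D(3)]]])
    fix p assume "p \<in> U"
    then have "linear (frechet_derivative \<phi> (at p))" by (rule D)
    then show "frechet_derivative \<phi> (at p) (0, 1, 0) -
        - fst p / 2 * frechet_derivative \<phi> (at p) (0, 0, 1) = vf_apply X2 \<phi> p"
      unfolding vf_apply_def X by (simp only: linear_diff linear_cmul real_scaleR_def)
  qed (use D in auto)
qed

lemma has_derivative_normalized:
  fixes a b :: "'a::real_normed_vector \<Rightarrow> real"
  assumes a: "(a has_derivative a') (at p)" and b: "(b has_derivative b') (at p)"
    and nz: "a p \<noteq> 0 \<or> b p \<noteq> 0"
  shows "((\<lambda>x. a x / sqrt ((a x)\<^sup>2 + (b x)\<^sup>2)) has_derivative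
    (\<lambda>v. ((b p)\<^sup>2 * a' v - a p * b p * b' v) / sqrt ((a p)\<^sup>2 + (b p)\<^sup>2) ^ 3)) (at p)"
proof -
  define W where "W = sqrt ((a p)\<^sup>2 + (b p)\<^sup>2)"
  have pos: "(a p)\<^sup>2 + (b p)\<^sup>2 > 0" using nz by (simp add: sum_power2_gt_zero_iff)
  then have W: "W > 0" "W\<^sup>2 = (a p)\<^sup>2 + (b p)\<^sup>2" by (auto simp: W_def)
  have dq: "((\<lambda>x. (a x)\<^sup>2 + (b x)\<^sup>2) has_derivative (\<lambda>v. 2 * a p * a' v + 2 * b p * b' v)) (at p)"
    by (auto intro!: derivative_eq_intros a b)
  have dW: "((\<lambda>x. sqrt ((a x)\<^sup>2 + (b x)\<^sup>2)) has_derivative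
      (\<lambda>v. (2 * a p * a' v + 2 * b p * b' v) * (inverse W / 2))) (at p)"
    by (rule has_derivative_eq_rhs[OF has_derivative_real_sqrt[OF pos dq]])
      (simp add: W_def fun_eq_iff field_simps)
  have "sqrt ((a p)\<^sup>2 + (b p)\<^sup>2) \<noteq> 0" using W(1) unfolding W_def by linarith
  from has_derivative_divide[OF a dW this]
  have "((\<lambda>x. a x / sqrt ((a x)\<^sup>2 + (b x)\<^sup>2)) has_derivative
    (\<lambda>v. - a p * (inverse W * ((2 * a p * a' v + 2 * b p * b' v) * (inverse W / 2)) * inverse W) + a' v / W)) (at p)"
    unfolding W_def .
  moreover have "- a p * (inverse W * ((2 * a p * a' v + 2 * b p * b' v) * (inverse W / 2)) * inverse W) + a' v / W
    = ((b p)\<^sup>2 * a' v - a p * b p * b' v) / W ^ 3" for v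
  proof -
    have "- a p * (inverse W * ((2 * a p * a' v + 2 * b p * b' v) * (inverse W / 2)) * inverse W) + a' v / W
      = (a' v * W\<^sup>2 - a p * (a p * a' v + b p * b' v)) / W ^ 3"
      using W(1) by (simp add: field_simps power2_eq_square power3_eq_cube)
    also have "a' v * W\<^sup>2 - a p * (a p * a' v + b p * b' v) = (b p)\<^sup>2 * a' v - a p * b p * b' v"
      unfolding W(2) by (simp add: algebra_simps power2_eq_square)
    finally show ?thesis .
  qed
  ultimately show ?thesis by (simp add: W_def)
qed

lemma vf_apply_eqI: "(f has_derivative f') (at g) \<Longrightarrow> vf_apply X f g = f' (X g)"
  unfolding vf_apply_def by (metis frechet_derivative_at)

text \<open>With \<open>Z = b X\<^sub>1 - a X\<^sub>2\<close>, where \<open>a = X\<^sub>1 \<phi>\<close> and \<open>b = X\<^sub>2 \<phi>\<close>,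
  vanishing curvature reads \<open>b Z a - a Z b = 0\<close>: the direction of \<open>(a, b)\<close> is
  stationary along \<open>Z\<close>.\<close>

lemma H_mean_curvature_zero_expand:
  assumes S: "C2_defining_function S U \<phi>" and g: "g \<in> U"
    and nz: "vf_apply X1 \<phi> g \<noteq> 0 \<or> vf_apply X2 \<phi> g \<noteq> 0"
    and H: "H_mean_curvature \<phi> g = 0"
  defines "a \<equiv> vf_apply X1 \<phi>" and "b \<equiv> vf_apply X2 \<phi>"
  shows "(b g)\<^sup>2 * vf_apply X1 a g - a g * b g * (vf_apply X1 b g + vf_apply X2 a g)
    + (a g)\<^sup>2 * vf_apply X2 b g = 0"
proof -
  let ?W = "sqrt ((a g)\<^sup>2 + (b g)\<^sup>2)"
  have nz': "a g \<noteq> 0 \<or> b g \<noteq> 0" using nz by (simp add: a_def b_def)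
  then have W: "?W > 0" by (simp add: sum_power2_gt_zero_iff)
  have da: "(a has_derivative frechet_derivative a (at g)) (at g)"
    and db: "(b has_derivative frechet_derivative b (at g)) (at g)"
    using C1_on_has_derivative C1_on_vf_apply[OF S] g by (auto simp: a_def b_def)
  have 1: "vf_apply X1 (\<lambda>p. a p / sqrt ((a p)\<^sup>2 + (b p)\<^sup>2)) g
      = ((b g)\<^sup>2 * vf_apply X1 a g - a g * b g * vf_apply X1 b g) / ?W ^ 3"
    using vf_apply_eqI[OF has_derivative_normalized[OF da db nz']]
    by (simp only: vf_apply_def)
  have "vf_apply X2 (\<lambda>p. b p / sqrt ((b p)\<^sup>2 + (a p)\<^sup>2)) g
      = ((a g)\<^sup>2 * vf_apply X2 b g - b g * a g * vf_apply X2 a g) / sqrt ((b g)\<^sup>2 + (a g)\<^sup>2) ^ 3"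
    using vf_apply_eqI[OF has_derivative_normalized[OF db da]] nz'
    by (simp only: vf_apply_def disj_commute)
  then have 2: "vf_apply X2 (\<lambda>p. b p / sqrt ((a p)\<^sup>2 + (b p)\<^sup>2)) g
      = ((a g)\<^sup>2 * vf_apply X2 b g - a g * b g * vf_apply X2 a g) / ?W ^ 3"
    by (simp add: add.commute mult.commute)
  have "((b g)\<^sup>2 * vf_apply X1 a g - a g * b g * vf_apply X1 b g) / ?W ^ 3
      + ((a g)\<^sup>2 * vf_apply X2 b g - a g * b g * vf_apply X2 a g) / ?W ^ 3 = 0"
    using H 1 2 by (simp add: H_mean_curvature_def hor_grad_norm_def a_def b_def)
  then show ?thesis
    using W nz' by (auto simp: add_divide_distrib[symmetric] algebra_simps)
qed

lemma isCont_locally_bounded: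
  fixes f :: "real \<Rightarrow> real"
  assumes "isCont f 0"
  shows "eventually (\<lambda>s. \<bar>f s\<bar> \<le> \<bar>f 0\<bar> + 1) (nhds 0)"
proof -
  have "eventually (\<lambda>s. dist (f s) (f 0) < 1) (nhds 0)"
    using assms unfolding isCont_def tendsto_at_iff_tendsto_nhds by (rule tendstoD) simp
  then show ?thesis
    by eventually_elim (auto simp: dist_real_def)
qed

text \<open>Gronwall applies to \<open>\<delta>\<^sup>2 + \<sigma>\<^sup>2\<close>: near 0 the
  coefficients are bounded by \<open>M\<close>, and twice the square sum bounds the square of
  \<open>\<bar>\<delta>\<bar> + \<bar>\<sigma>\<bar>\<close>, which gives the factor
  \<open>4 * M\<close>.\<close>

lemma linear_system_zero:
  fixes \<delta> \<sigma> \<alpha> \<beta> \<kappa> \<mu> :: "real \<Rightarrow> real"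
  assumes "r > 0"
    and \<delta>: "\<And>s. \<bar>s\<bar> < r \<Longrightarrow> (\<delta> has_real_derivative \<alpha> s * \<delta> s + \<beta> s * \<sigma> s) (at s)"
    and \<sigma>: "\<And>s. \<bar>s\<bar> < r \<Longrightarrow> (\<sigma> has_real_derivative \<kappa> s * \<delta> s + \<mu> s * \<sigma> s) (at s)"
    and "\<delta> 0 = 0" "\<sigma> 0 = 0"
    and cont: "isCont \<alpha> 0" "isCont \<beta> 0" "isCont \<kappa> 0" "isCont \<mu> 0"
  shows "\<exists>\<epsilon>>0. \<forall>s. \<bar>s\<bar> < \<epsilon> \<longrightarrow> \<bar>s\<bar> < r \<and> \<delta> s = 0"
proof -
  define M where "M = \<bar>\<alpha> 0\<bar> + \<bar>\<beta> 0\<bar> + \<bar>\<kappa> 0\<bar> + \<bar>\<mu> 0\<bar> + 1"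
  have "eventually (\<lambda>s. \<bar>\<alpha> s\<bar> \<le> M \<and> \<bar>\<beta> s\<bar> \<le> M \<and> \<bar>\<kappa> s\<bar> \<le> M \<and> \<bar>\<mu> s\<bar> \<le> M) (nhds 0)"
    using isCont_locally_bounded[OF cont(1)] isCont_locally_bounded[OF cont(2)]
      isCont_locally_bounded[OF cont(3)] isCont_locally_bounded[OF cont(4)]
    by eventually_elim (unfold M_def, smt (verit))
  then obtain d where d: "d > 0"
    "\<And>s. \<bar>s\<bar> < d \<Longrightarrow> \<bar>\<alpha> s\<bar> \<le> M \<and> \<bar>\<beta> s\<bar> \<le> M \<and> \<bar>\<kappa> s\<bar> \<le> M \<and> \<bar>\<mu> s\<bar> \<le> M"
    by (auto simp: eventually_nhds_metric dist_real_def)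
  define \<epsilon> where "\<epsilon> = min d r"
  let ?E = "\<lambda>s. (\<delta> s)\<^sup>2 + (\<sigma> s)\<^sup>2"
  let ?E' = "\<lambda>s. 2 * \<delta> s * (\<alpha> s * \<delta> s + \<beta> s * \<sigma> s) + 2 * \<sigma> s * (\<kappa> s * \<delta> s + \<mu> s * \<sigma> s)"
  have "?E s = 0" if "\<bar>s\<bar> < \<epsilon>" for s
  proof (rule gronwall_zero[where E="?E" and E'="?E'" and K="4 * M" and \<epsilon>=\<epsilon>])
    fix s assume s: "\<bar>s\<bar> < \<epsilon>"
    then show "(?E has_real_derivative ?E' s) (at s)"
      by (auto intro!: derivative_eq_intros \<delta> \<sigma> simp: \<epsilon>_def)
    let ?p = "\<bar>\<delta> s\<bar>" and ?q = "\<bar>\<sigma> s\<bar>"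
    have M: "\<bar>\<alpha> s\<bar> \<le> M" "\<bar>\<beta> s\<bar> \<le> M" "\<bar>\<kappa> s\<bar> \<le> M" "\<bar>\<mu> s\<bar> \<le> M"
      using d s by (auto simp: \<epsilon>_def)
    have "\<bar>\<alpha> s * \<delta> s + \<beta> s * \<sigma> s\<bar> \<le> M * ?p + M * ?q"
      using M by (intro order_trans[OF abs_triangle_ineq] add_mono) (auto simp: abs_mult mult_right_mono)
    moreover have "\<bar>\<kappa> s * \<delta> s + \<mu> s * \<sigma> s\<bar> \<le> M * ?p + M * ?q"
      using M by (intro order_trans[OF abs_triangle_ineq] add_mono) (auto simp: abs_mult mult_right_mono)
    ultimately have "\<bar>?E' s\<bar> \<le> 2 * ?p * (M * ?p + M * ?q) + 2 * ?q * (M * ?p + M * ?q)"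
      by (intro order_trans[OF abs_triangle_ineq] add_mono) (auto simp: abs_mult mult_left_mono)
    also have "\<dots> = 2 * M * (?p + ?q)\<^sup>2" by (simp add: algebra_simps power2_eq_square)
    also have "\<dots> \<le> 2 * M * (2 * (?p\<^sup>2 + ?q\<^sup>2))"
    proof (rule mult_left_mono)
      show "(?p + ?q)\<^sup>2 \<le> 2 * (?p\<^sup>2 + ?q\<^sup>2)"
        using zero_le_power2[of "?p - ?q"] by (simp add: power2_eq_square algebra_simps)
    qed (simp add: M_def)
    finally show "\<bar>?E' s\<bar> \<le> 4 * M * ?E s" by (simp add: algebra_simps)
  qed (use assms that in auto)
  then have "\<delta> s = 0" if "\<bar>s\<bar> < \<epsilon>" for s
    using that by (metis sum_power2_eq_zero_iff)
  then show ?thesis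
    using d(1) \<open>r > 0\<close> by (intro exI[of _ \<epsilon>]) (auto simp: \<epsilon>_def)
qed

lemma continuous_on_vf_apply:
  assumes f: "C1_on f U" "open U" and X: "continuous_on U X"
  shows "continuous_on U (vf_apply X f)"
  unfolding vf_apply_def
  using continuous_on_frechet_derivative_apply[OF f(1) continuous_on_id _ X] by simp

lemma continuous_on_X1: "continuous_on U X1" and continuous_on_X2: "continuous_on U X2"
  unfolding X1_def X2_def case_prod_beta by (auto intro!: continuous_intros)

lemma horizontal_segment:
  assumes S: "C2_defining_function S U \<phi>" and g: "g \<in> U" "g \<in> S"
    and nc: "\<And>p. p \<in> U \<Longrightarrow> p \<in> S \<Longrightarrow> vf_apply X1 \<phi> p \<noteq> 0 \<or> vf_apply X2 \<phi> p \<noteq> 0"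
    and H: "\<And>p. p \<in> U \<Longrightarrow> p \<in> S \<Longrightarrow> H_mean_curvature \<phi> p = 0"
  shows "\<exists>\<epsilon>>0. \<forall>s. \<bar>s\<bar> < \<epsilon> \<longrightarrow> g + s *\<^sub>R hor g (vf_apply X2 \<phi> g) (- vf_apply X1 \<phi> g) \<in> S"
proof -
  note D = defining_functionD[OF S]
  let ?D = "\<lambda>p. frechet_derivative \<phi> (at p)"
  define T :: heis where "T = (0, 0, 1)"
  define a where "a = vf_apply X1 \<phi>"
  define b where "b = vf_apply X2 \<phi>"
  define a0 where "a0 = a g"
  define b0 where "b0 = b g"
  define V where "V = hor g b0 (- a0)"
  define w where "w = hor g a0 b0"
  \<comment> \<open>A displacement by \<open>\<delta> w\<close> lowers the vertical coefficient of
    the horizontal vector with coordinates \<open>(b0, - a0)\<close> by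
    \<open>\<kappa> \<delta>\<close>. So \<open>V\<close> stays horizontal along
    \<open>\<Gamma>\<close> up to this vertical error.\<close>
  define \<kappa> where "\<kappa> = (a0\<^sup>2 + b0\<^sup>2) / 2"
  have nz: "a p \<noteq> 0 \<or> b p \<noteq> 0" if "p \<in> U" "p \<in> S" for p
    using nc[OF that] by (simp add: a_def b_def)
  have C1: "C1_on a U" "C1_on b U" using C1_on_vf_apply[OF S] by (simp_all add: a_def b_def)
  let ?A = "\<lambda>p. frechet_derivative a (at p)" and ?B = "\<lambda>p. frechet_derivative b (at p)"
  have lin: "linear (?D p)" "linear (?A p)" "linear (?B p)" if "p \<in> U" for p
    using D(6) that C1_on_has_derivative[OF C1(1) that] C1_on_has_derivative[OF C1(2) that]
      has_derivative_linear by blast+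
  have \<phi>g: "\<phi> g = 0" using D(4) g by blast
  have "?D g w = a0\<^sup>2 + b0\<^sup>2"
    unfolding w_def linear_hor[OF lin(1)[OF g(1)]]
    by (simp add: a0_def b0_def a_def b_def vf_apply_def power2_eq_square)
  then have w: "?D g w \<noteq> 0"
    using nz[OF g] by (simp add: a0_def b0_def sum_power2_eq_zero_iff)
  obtain r \<delta> where r: "r > 0" and \<delta>0: "\<delta> 0 = 0"
    and \<delta>: "\<forall>s. \<bar>s\<bar> < r \<longrightarrow> g + s *\<^sub>R V + \<delta> s *\<^sub>R w \<in> U \<and> \<phi> (g + s *\<^sub>R V + \<delta> s *\<^sub>R w) = 0 \<and>
       ?D (g + s *\<^sub>R V + \<delta> s *\<^sub>R w) w \<noteq> 0"
    and \<delta>': "\<forall>s. \<bar>s\<bar> < r \<longrightarrow> (\<delta> has_real_derivative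
       - ?D (g + s *\<^sub>R V + \<delta> s *\<^sub>R w) V / ?D (g + s *\<^sub>R V + \<delta> s *\<^sub>R w) w) (at s)"
    using C1_implicit_curve[OF D(2,1) g(1) \<phi>g w, of V] by blast
  define \<Gamma> where "\<Gamma> = (\<lambda>s. g + s *\<^sub>R V + \<delta> s *\<^sub>R w)"
  have \<Gamma>: "\<Gamma> s \<in> U" "\<Gamma> s \<in> S" "?D (\<Gamma> s) w \<noteq> 0" if "\<bar>s\<bar> < r" for s
    using \<delta> that D(4) by (auto simp: \<Gamma>_def)
  have \<Gamma>0: "\<Gamma> 0 = g" using \<delta>0 by (simp add: \<Gamma>_def)
  have V: "V = hor (\<Gamma> s) b0 (- a0) + (\<kappa> * \<delta> s) *\<^sub>R T" for s
    by (cases g) (simp add: V_def \<Gamma>_def w_def T_def \<kappa>_def hor_Pair field_simps power2_eq_square)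
  have linV: "f V = b0 * f (X1 (\<Gamma> s)) - a0 * f (X2 (\<Gamma> s)) + \<kappa> * \<delta> s * f T" if "linear f" for f s
  proof -
    have "f V = f (hor (\<Gamma> s) b0 (- a0)) + \<kappa> * \<delta> s * f T"
      by (subst V[of s]) (simp only: linear_add[OF that] linear_cmul[OF that] real_scaleR_def)
    then show ?thesis by (simp add: linear_hor[OF that])
  qed
  \<comment> \<open>The planar determinant of the horizontal gradient at \<open>\<Gamma> s\<close>
    with the one at g: it vanishes when the normal has not turned.\<close>
  define \<sigma> where "\<sigma> = (\<lambda>s. b0 * a (\<Gamma> s) - a0 * b (\<Gamma> s))"
  define W2 where "W2 = (\<lambda>p. (a p)\<^sup>2 + (b p)\<^sup>2)"
  \<comment> \<open>\<open>l\<close> and \<open>m\<close> are the coordinates of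
    \<open>(a0, b0)\<close> in the moving orthogonal frame \<open>(a, b)\<close>,
    \<open>(- b, a)\<close>. Since \<open>\<sigma>\<close> is \<open>m\<close> times
    \<open>W2\<close> along \<open>\<Gamma>\<close>, a factor \<open>m\<close> can be traded for a
    factor \<open>\<sigma>\<close>.\<close>
  define l where "l = (\<lambda>p. (a p * a0 + b p * b0) / W2 p)"
  define m where "m = (\<lambda>p. (b0 * a p - a0 * b p) / W2 p)"
  \<comment> \<open>The cofactor of \<open>m\<close> in the quadratic form of the curvature
    equation, evaluated at \<open>(a0, b0)\<close> instead of \<open>(a, b)\<close>, divided by
    \<open>W2\<close>.\<close>
  define K where "K = (\<lambda>p. ((2 * l p * a p * b p + m p * (a p)\<^sup>2) * vf_apply X1 a p
     - (l p * ((a p)\<^sup>2 - (b p)\<^sup>2) - m p * a p * b p) * (vf_apply X2 a p + vf_apply X1 b p)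
     + (m p * (b p)\<^sup>2 - 2 * l p * a p * b p) * vf_apply X2 b p) / W2 p)"
  define \<tau> where "\<tau> = (\<lambda>p. b0 * ?A p T - a0 * ?B p T)"
  define \<rho> where "\<rho> = (\<lambda>p. b0 * ?A p w - a0 * ?B p w)"
  define \<alpha> where "\<alpha> = (\<lambda>p. - \<kappa> * ?D p T / ?D p w)"
  define \<beta> where "\<beta> = (\<lambda>p. - 1 / ?D p w)"
  have d\<delta>: "(\<delta> has_real_derivative \<alpha> (\<Gamma> s) * \<delta> s + \<beta> (\<Gamma> s) * \<sigma> s) (at s)" if s: "\<bar>s\<bar> < r" for s
  proof -
    have "?D (\<Gamma> s) V = \<sigma> s + \<kappa> * \<delta> s * ?D (\<Gamma> s) T"
      unfolding linV[OF lin(1)[OF \<Gamma>(1)[OF s]], of s] by (simp add: \<sigma>_def a_def b_def vf_apply_def)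
    then have "- ?D (\<Gamma> s) V / ?D (\<Gamma> s) w = \<alpha> (\<Gamma> s) * \<delta> s + \<beta> (\<Gamma> s) * \<sigma> s"
      by (simp add: \<alpha>_def \<beta>_def add_divide_distrib diff_divide_distrib algebra_simps)
    then show ?thesis using \<delta>'[rule_format, OF s] by (simp add: \<Gamma>_def)
  qed
  have d\<Gamma>: "(\<Gamma> has_derivative (\<lambda>h. h *\<^sub>R (V + (\<alpha> (\<Gamma> s) * \<delta> s + \<beta> (\<Gamma> s) * \<sigma> s) *\<^sub>R w))) (at s)"
    if s: "\<bar>s\<bar> < r" for s
    using d\<delta>[OF s] unfolding has_field_derivative_def
    by (subst \<Gamma>_def) (auto intro!: derivative_eq_intros simp: algebra_simps)
  have d\<sigma>: "(\<sigma> has_real_derivative (\<kappa> * \<tau> (\<Gamma> s) + \<rho> (\<Gamma> s) * \<alpha> (\<Gamma> s)) * \<delta> s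
      + (K (\<Gamma> s) + \<rho> (\<Gamma> s) * \<beta> (\<Gamma> s)) * \<sigma> s) (at s)" if s: "\<bar>s\<bar> < r" for s
  proof -
    define p where "p = \<Gamma> s"
    have p: "p \<in> U" "p \<in> S" using \<Gamma> s by (auto simp: p_def)
    define d where "d = \<alpha> p * \<delta> s + \<beta> p * \<sigma> s"
    define c where "c = b0 * ?A p (V + d *\<^sub>R w) - a0 * ?B p (V + d *\<^sub>R w)"
    have "((\<lambda>s. a (\<Gamma> s)) has_derivative (\<lambda>h. ?A p (h *\<^sub>R (V + d *\<^sub>R w)))) (at s)"
      using has_derivative_compose[OF d\<Gamma>[OF s] C1_on_has_derivative[OF C1(1) \<Gamma>(1)[OF s]]]
      by (simp add: p_def d_def)
    moreover have "((\<lambda>s. b (\<Gamma> s)) has_derivative (\<lambda>h. ?B p (h *\<^sub>R (V + d *\<^sub>R w)))) (at s)"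
      using has_derivative_compose[OF d\<Gamma>[OF s] C1_on_has_derivative[OF C1(2) \<Gamma>(1)[OF s]]]
      by (simp add: p_def d_def)
    ultimately have "(\<sigma> has_derivative (\<lambda>h. b0 * ?A p (h *\<^sub>R (V + d *\<^sub>R w)) - a0 * ?B p (h *\<^sub>R (V + d *\<^sub>R w)))) (at s)"
      unfolding \<sigma>_def by (intro has_derivative_diff has_derivative_mult_right)
    moreover have "b0 * ?A p (h *\<^sub>R (V + d *\<^sub>R w)) - a0 * ?B p (h *\<^sub>R (V + d *\<^sub>R w)) = c * h" for h
      unfolding linear_cmul[OF lin(2)[OF p(1)]] linear_cmul[OF lin(3)[OF p(1)]] c_def
      by (simp add: algebra_simps)
    ultimately have "(\<sigma> has_derivative (\<lambda>h. c * h)) (at s)" by (simp only:)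
    then have "(\<sigma> has_real_derivative c) (at s)" unfolding has_field_derivative_def .
    moreover have "c = (\<kappa> * \<tau> p + \<rho> p * \<alpha> p) * \<delta> s + (K p + \<rho> p * \<beta> p) * \<sigma> s"
    proof -
      define x1a x2a x1b x2b where x: "x1a = vf_apply X1 a p" "x2a = vf_apply X2 a p"
        "x1b = vf_apply X1 b p" "x2b = vf_apply X2 b p"
      have flat: "(b p)\<^sup>2 * x1a - a p * b p * (x1b + x2a) + (a p)\<^sup>2 * x2b = 0"
        using H_mean_curvature_zero_expand[OF S p(1) nc[OF p] H[OF p]] by (simp add: x a_def b_def)
      have W2: "W2 p \<noteq> 0" using nz[OF p] by (simp add: W2_def sum_power2_eq_zero_iff)
      have lW: "l p * W2 p = a p * a0 + b p * b0" "m p * W2 p = b0 * a p - a0 * b p"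
        using W2 by (simp_all add: l_def m_def)
      have "W2 p * (l p * a p - m p * b p) = W2 p * a0"
        using lW unfolding W2_def power2_eq_square by algebra
      then have a0: "a0 = l p * a p - m p * b p" using W2 by simp
      have "W2 p * (l p * b p + m p * a p) = W2 p * b0"
        using lW unfolding W2_def power2_eq_square by algebra
      then have b0: "b0 = l p * b p + m p * a p" using W2 by simp
      have \<sigma>: "\<sigma> s = m p * W2 p" using lW by (simp add: \<sigma>_def p_def)
      \<comment> \<open>The part without the factor \<open>M\<close> is \<open>L\<^sup>2\<close>
        times the curvature expression, hence zero at points of S.\<close>
      have quad: "(L * B + M * A)\<^sup>2 * x1 - (L * A - M * B) * (L * B + M * A) * (x2 + y1) + (L * A - M * B)\<^sup>2 * y2
        = L\<^sup>2 * (B\<^sup>2 * x1 - A * B * (y1 + x2) + A\<^sup>2 * y2)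
          + M * ((2 * L * A * B + M * A\<^sup>2) * x1 - (L * (A\<^sup>2 - B\<^sup>2) - M * A * B) * (x2 + y1)
              + (M * B\<^sup>2 - 2 * L * A * B) * y2)" for A B L M x1 x2 y1 y2 :: real
        by (simp add: algebra_simps power2_eq_square)
      have KW: "(2 * l p * a p * b p + m p * (a p)\<^sup>2) * x1a
          - (l p * ((a p)\<^sup>2 - (b p)\<^sup>2) - m p * a p * b p) * (x2a + x1b)
          + (m p * (b p)\<^sup>2 - 2 * l p * a p * b p) * x2b = K p * W2 p"
        using W2 by (simp add: K_def x)
      have "b0\<^sup>2 * x1a - a0 * b0 * (x2a + x1b) + a0\<^sup>2 * x2b = (l p)\<^sup>2 * 0 + m p * (K p * W2 p)"
        using quad[of "l p" "b p" "m p" "a p" x1a x2a x1b x2b]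
        unfolding flat KW a0[symmetric] b0[symmetric] .
      also have "\<dots> = K p * \<sigma> s" by (simp add: \<sigma>)
      finally have Q: "b0\<^sup>2 * x1a - a0 * b0 * (x2a + x1b) + a0\<^sup>2 * x2b = K p * \<sigma> s" .
      \<comment> \<open>The horizontal part of \<open>V\<close> contributes the quadratic form, its
        vertical error the term with \<open>\<tau>\<close>, and the drift along \<open>w\<close> the
        term with \<open>\<rho>\<close>.\<close>
      have "c = (b0\<^sup>2 * x1a - a0 * b0 * (x2a + x1b) + a0\<^sup>2 * x2b) + \<kappa> * \<tau> p * \<delta> s + d * \<rho> p"
        unfolding c_def linear_add[OF lin(2)[OF p(1)]] linear_add[OF lin(3)[OF p(1)]]
          linear_cmul[OF lin(2)[OF p(1)]] linear_cmul[OF lin(3)[OF p(1)]]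
          linV[OF lin(2)[OF p(1)], of s] linV[OF lin(3)[OF p(1)], of s]
        by (simp add: x vf_apply_def p_def \<tau>_def \<rho>_def algebra_simps power2_eq_square)
      then show ?thesis unfolding Q d_def by (simp add: algebra_simps)
    qed
    ultimately show ?thesis by (simp add: p_def)
  qed
  have "isCont \<Gamma> 0" using d\<Gamma>[of 0] r has_derivative_continuous by fastforce
  then have comp: "isCont (\<lambda>s. f (\<Gamma> s)) 0" if "isCont f g" for f :: "heis \<Rightarrow> real"
    using that \<Gamma>0 isCont_o2 by metis
  have cD: "isCont (\<lambda>p. ?D p v) g" "isCont (\<lambda>p. ?A p v) g" "isCont (\<lambda>p. ?B p v) g" for v
    using C1_on_isCont_derivative D(1,2) C1 g by blast+
  have cX: "isCont (vf_apply X1 a) g" "isCont (vf_apply X2 a) g" "isCont (vf_apply X1 b) g" "isCont (vf_apply X2 b) g"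
    using continuous_on_vf_apply[OF _ D(1)] C1 continuous_on_X1 continuous_on_X2
      continuous_on_eq_continuous_at[OF D(1)] g by blast+
  have cab: "isCont a g" "isCont b g"
    using C1_on_continuous_on[OF C1(1)] C1_on_continuous_on[OF C1(2)]
      continuous_on_eq_continuous_at[OF D(1)] g by blast+
  have W2: "W2 g \<noteq> 0" using nz[OF g] by (simp add: W2_def sum_power2_eq_zero_iff)
  have cW2: "isCont W2 g" unfolding W2_def by (intro continuous_intros cab)
  have clm: "isCont l g" "isCont m g"
    unfolding l_def m_def using W2 by (intro continuous_intros cab cW2; simp)+
  have cK: "isCont K g"
    unfolding K_def using W2 by (intro continuous_intros cab cW2 clm cX; simp)
  have c\<tau>: "isCont \<tau> g" "isCont \<rho> g" unfolding \<tau>_def \<rho>_def by (intro continuous_intros cD)+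
  have c\<alpha>: "isCont \<alpha> g" "isCont \<beta> g"
    unfolding \<alpha>_def \<beta>_def using w by (intro continuous_intros cD; simp)+
  have \<sigma>0: "\<sigma> 0 = 0" by (simp add: \<sigma>_def \<Gamma>0 a0_def b0_def)
  have "\<exists>\<epsilon>>0. \<forall>s. \<bar>s\<bar> < \<epsilon> \<longrightarrow> \<bar>s\<bar> < r \<and> \<delta> s = 0"
    by (rule linear_system_zero[OF r d\<delta> d\<sigma> \<delta>0 \<sigma>0])
      (assumption | intro continuous_intros comp cK c\<tau> c\<alpha>)+
  then obtain \<epsilon> where \<epsilon>: "\<epsilon> > 0" "\<And>s. \<bar>s\<bar> < \<epsilon> \<Longrightarrow> \<bar>s\<bar> < r \<and> \<delta> s = 0" by blast
  have "g + s *\<^sub>R V \<in> S" if "\<bar>s\<bar> < \<epsilon>" for s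
    using \<Gamma>(2)[of s] \<epsilon>(2)[OF that] by (simp add: \<Gamma>_def)
  then show ?thesis
    using \<epsilon>(1) by (auto simp: V_def a0_def b0_def a_def b_def)
qed

subsection \<open>Complete horizontal lines in entire graphs\<close>

locale minimal_graph =
  fixes S :: "heis set" and n :: heis
  assumes surface: "C2_surface S"
    and noncharacteristic: "characteristic_locus S = {}"
    and minimal: "H_minimal S"
    and graph: "\<exists>!s. z + s *\<^sub>R n \<in> S"
begin

lemma n_nonzero: "n \<noteq> 0"
proof
  assume "n = 0"
  then have "\<exists>!s::real. (0::heis) \<in> S" using graph[of 0] by simp
  then show False by (metis zero_neq_one)
qed

lemma graph_unique: "z \<in> S \<Longrightarrow> z + s *\<^sub>R n \<in> S \<Longrightarrow> s = 0"
  using graph[of z] by (metis add.right_neutral scaleR_zero_left)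

lemma chart:
  assumes "g \<in> S"
  obtains U \<phi> where "C2_defining_function S U \<phi>" "g \<in> U"
  using surface assms unfolding C2_surface_def by blast

text \<open>A retraction of space onto S. Once it is known to be continuous, S is closed as its
  fixed point set and connected as its image.\<close>

definition foot :: "heis \<Rightarrow> heis" where
  "foot z = z + (THE s. z + s *\<^sub>R n \<in> S) *\<^sub>R n"

lemma foot_in: "foot z \<in> S"
  unfolding foot_def using theI'[OF graph] .

lemma foot_eqI: "z + s *\<^sub>R n \<in> S \<Longrightarrow> foot z = z + s *\<^sub>R n"
  unfolding foot_def using the1_equality[OF graph] by metis

lemma foot_eq_self_iff: "foot z = z \<longleftrightarrow> z \<in> S"
  using foot_in[of z] foot_eqI[of z 0] by auto

lemma foot_decompose: "\<exists>s. foot z = z + s *\<^sub>R n"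
  unfolding foot_def by blast

text \<open>Locally \<open>S\<close> is parametrized by a plane; thickening the parametrization in the direction
  \<open>n\<close> gives an injective continuous map of an open subset of space, which is open by
  invariance of domain.\<close>

lemma isCont_foot: "isCont foot z"
proof -
  define g where "g = foot z"
  obtain s0 where s0: "g = z + s0 *\<^sub>R n" using foot_decompose g_def by blast
  have "g \<in> S" using foot_in by (simp add: g_def)
  then obtain U \<phi> where S: "C2_defining_function S U \<phi>" and gU: "g \<in> U" by (rule chart)
  note D = defining_functionD[OF S]
  let ?D = "\<lambda>p. frechet_derivative \<phi> (at p)"
  obtain w where w: "?D g w \<noteq> 0" using S gU unfolding C2_defining_function_def by blast
  have "w \<noteq> 0" using w linear_0[OF D(6)[OF gU]] by blast
  then have ww: "w \<bullet> w \<noteq> 0" by simp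
  have \<phi>g: "\<phi> g = 0" using D(4) gU \<open>g \<in> S\<close> by blast
  obtain \<epsilon> \<delta> where \<epsilon>: "\<epsilon> > 0" "\<delta> g = 0"
    "\<And>y. y \<in> ball g \<epsilon> \<Longrightarrow> y + \<delta> y *\<^sub>R w \<in> U \<and> \<phi> (y + \<delta> y *\<^sub>R w) = 0 \<and> ?D (y + \<delta> y *\<^sub>R w) w \<noteq> 0"
    "\<And>y. y \<in> ball g \<epsilon> \<Longrightarrow> (\<delta> has_derivative
       (\<lambda>v. - ?D (y + \<delta> y *\<^sub>R w) v / ?D (y + \<delta> y *\<^sub>R w) w)) (at y)"
    using C1_implicit_function[OF D(2,1) gU \<phi>g w] by blast
  define q where "q = (\<lambda>y. y + \<delta> y *\<^sub>R w)"
  have q: "q y \<in> S" if "y \<in> ball g \<epsilon>" for y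
    using \<epsilon>(3)[OF that] D(4) by (simp add: q_def)
  have cont\<delta>: "isCont \<delta> y" if "y \<in> ball g \<epsilon>" for y
    using \<epsilon>(4)[OF that] has_derivative_continuous by blast
  have contq: "isCont q y" if "y \<in> ball g \<epsilon>" for y
    unfolding q_def by (intro continuous_intros cont\<delta>[OF that])
  \<comment> \<open>\<open>c\<close> is the coordinate along \<open>w\<close> measured from g, and
    \<open>P\<close> projects onto the hyperplane \<open>c = 0\<close>, over which \<open>q\<close>
    parametrizes S.\<close>
  define c where "c = (\<lambda>y. ((y - g) \<bullet> w) / (w \<bullet> w))"
  define P where "P = (\<lambda>y. y - c y *\<^sub>R w)"
  \<comment> \<open>The coordinate along \<open>w\<close> is reused as displacement along n. Since
    \<open>foot\<close> removes this displacement, both parts can be recovered from the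
    value.\<close>
  define \<Psi> where "\<Psi> = (\<lambda>y. q (P y) + c y *\<^sub>R n)"
  have contc: "isCont c y" for y
    unfolding c_def using ww by (intro continuous_intros) auto
  have contP: "isCont P y" for y
    unfolding P_def by (intro continuous_intros contc)
  have footPsi: "foot (\<Psi> y) = q (P y)" if "P y \<in> ball g \<epsilon>" for y
    using foot_eqI[of "\<Psi> y" "- c y"] q[OF that] by (simp add: \<Psi>_def)
  have cP: "c (P y) = 0" for y
    using ww by (simp add: P_def c_def algebra_simps inner_diff_left add_divide_distrib diff_divide_distrib)
  show ?thesis
    unfolding isCont_def
  proof (rule topological_tendstoI)
    fix N assume N: "open N" "foot z \<in> N"
    then have "q g \<in> N" using \<epsilon>(2) by (simp add: q_def g_def)
    then have "eventually (\<lambda>y. q y \<in> N) (nhds g)"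
      using contq[of g] \<epsilon>(1) N(1) unfolding isCont_def tendsto_at_iff_tendsto_nhds
      by (auto dest: topological_tendstoD)
    then obtain \<epsilon>' where \<epsilon>': "\<epsilon>' > 0" "\<And>y. dist y g < \<epsilon>' \<Longrightarrow> q y \<in> N"
      by (auto simp: eventually_nhds_metric)
    define Dm where "Dm = {y. P y \<in> ball g (min \<epsilon> \<epsilon>')}"
    have Dm: "P y \<in> ball g \<epsilon>" "q (P y) \<in> N" if "y \<in> Dm" for y
      using that \<epsilon>' by (auto simp: Dm_def dist_commute)
    have "open (P -` ball g (min \<epsilon> \<epsilon>'))"
      using contP by (intro open_vimage) (auto simp: continuous_at_imp_continuous_on)
    then have "open Dm" by (simp add: Dm_def vimage_def)
    moreover have "continuous_on Dm \<Psi>"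
    proof (rule continuous_at_imp_continuous_on, rule ballI)
      fix y assume "y \<in> Dm"
      then have "isCont q (P y)" using contq Dm by blast
      then have "isCont (\<lambda>y. q (P y)) y" using isCont_o2[OF contP] by blast
      then show "isCont \<Psi> y" unfolding \<Psi>_def by (intro continuous_intros contc)
    qed
    moreover have "inj_on \<Psi> Dm"
    proof (rule inj_onI)
      fix y y' assume y: "y \<in> Dm" "y' \<in> Dm" and eq: "\<Psi> y = \<Psi> y'"
      then have qq: "q (P y) = q (P y')" using footPsi Dm by metis
      then have "c (q (P y)) = c (q (P y'))" by simp
      moreover have "c (q (P x)) = c (P x) + \<delta> (P x)" for x
        using ww by (simp add: q_def c_def inner_add_left inner_diff_left add_divide_distrib diff_divide_distrib)
      ultimately have "\<delta> (P y) = \<delta> (P y')" by (simp add: cP)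
      then have PP: "P y = P y'" using qq by (simp add: q_def)
      have "c y = c y'" using eq qq n_nonzero by (simp add: \<Psi>_def)
      then show "y = y'" using PP by (simp add: P_def)
    qed
    ultimately have op: "open (\<Psi> ` Dm)" using invariance_of_domain by blast
    \<comment> \<open>The preimage of \<open>z\<close>: here \<open>P\<close> gives g and
      \<open>c\<close> gives \<open>- s0\<close>, and going back from g by \<open>s0\<close> along n
      reaches \<open>z\<close>.\<close>
    have cs: "c (g - s0 *\<^sub>R w) = - s0" using ww by (simp add: c_def)
    have Ps: "P (g - s0 *\<^sub>R w) = g" by (simp add: P_def cs)
    have "\<Psi> (g - s0 *\<^sub>R w) = z" by (simp add: \<Psi>_def cs Ps q_def \<epsilon>(2)) (simp add: s0)
    moreover have "g - s0 *\<^sub>R w \<in> Dm" using \<epsilon>(1) \<epsilon>'(1) by (simp add: Dm_def Ps)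
    ultimately have "z \<in> \<Psi> ` Dm" by (metis image_eqI)
    then have "eventually (\<lambda>y. y \<in> \<Psi> ` Dm) (at z)"
      using op eventually_at_topological by blast
    then show "eventually (\<lambda>y. foot y \<in> N) (at z)"
      by eventually_elim (use footPsi Dm in auto)
  qed
qed

lemma continuous_on_foot: "continuous_on A foot"
  using isCont_foot by (simp add: continuous_at_imp_continuous_on)

lemma closed_S: "closed S"
proof -
  have "closed {z. foot z = z}"
    by (intro closed_Collect_eq continuous_on_foot continuous_on_id)
  then show ?thesis by (simp add: foot_eq_self_iff)
qed

lemma connected_S: "connected S"
proof -
  have "foot ` UNIV = S"
  proof
    show "foot ` UNIV \<subseteq> S" using foot_in by blast
    show "S \<subseteq> foot ` UNIV"
    proof
      fix x assume "x \<in> S"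
      then have "x = foot x" using foot_eq_self_iff[of x] by simp
      then show "x \<in> foot ` UNIV" by (rule image_eqI) simp
    qed
  qed
  then show ?thesis
    using connected_continuous_image[OF continuous_on_foot convex_connected[OF convex_UNIV]] by simp
qed

text \<open>Differentials of defining functions are used instead of \<open>tangent_space\<close>
  because they make tangency linear in the vector and apply to curves that merely return to S
  frequently.\<close>

definition tangent :: "heis \<Rightarrow> heis \<Rightarrow> bool" where
  "tangent g v \<longleftrightarrow> (\<forall>U \<phi>. C2_defining_function S U \<phi> \<longrightarrow> g \<in> U \<longrightarrow> frechet_derivative \<phi> (at g) v = 0)"

lemma tangentI:
  assumes "(\<gamma> has_vector_derivative v) (at s)" "\<gamma> s \<in> S" "frequently (\<lambda>s. \<gamma> s \<in> S) (at s)"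
  shows "tangent (\<gamma> s) v"
  unfolding tangent_def using defining_function_derivative_zero assms by blast

lemma tangent_curve:
  assumes "(\<gamma> has_vector_derivative v) (at s)" "r > 0" "\<And>x. \<bar>x - s\<bar> < r \<Longrightarrow> \<gamma> x \<in> S"
  shows "tangent (\<gamma> s) v"
proof (rule tangentI)
  have "eventually (\<lambda>x. \<gamma> x \<in> S) (at s)"
    unfolding eventually_at using assms by (auto simp: dist_real_def)
  then show "frequently (\<lambda>s. \<gamma> s \<in> S) (at s)" by (simp add: eventually_frequently)
qed (use assms in auto)

lemma tangent_add_scale:
  assumes "tangent g v" "tangent g w"
  shows "tangent g (a *\<^sub>R v + b *\<^sub>R w)"
  unfolding tangent_def
proof (intro allI impI)
  fix U \<phi> assume S: "C2_defining_function S U \<phi>" "g \<in> U"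
  then have lin: "linear (frechet_derivative \<phi> (at g))" using defining_functionD(6) by blast
  show "frechet_derivative \<phi> (at g) (a *\<^sub>R v + b *\<^sub>R w) = 0"
    using assms S by (simp only: tangent_def linear_add[OF lin] linear_cmul[OF lin]) simp
qed

lemma tangent_hor_iff:
  assumes "C2_defining_function S U \<phi>" "g \<in> U" "g \<in> S" "tangent g (hor g a b)"
  shows "a * vf_apply X1 \<phi> g + b * vf_apply X2 \<phi> g = 0"
proof -
  have "frechet_derivative \<phi> (at g) (hor g a b) = 0"
    using assms unfolding tangent_def by blast
  then show ?thesis
    unfolding linear_hor[OF defining_functionD(6)[OF assms(1,2)]] vf_apply_def .
qed

text \<open>Two independent horizontal tangent vectors would make both \<open>X1 \<phi>\<close> and
  \<open>X2 \<phi>\<close> vanish. In this form the empty characteristic locus enters the arguments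
  about lines.\<close>

lemma tangent_hor_unique:
  assumes g: "g \<in> S" and "tangent g (hor g a b)" "tangent g (hor g a' b')"
  shows "a * b' = a' * b"
proof -
  obtain U \<phi> where S: "C2_defining_function S U \<phi>" "g \<in> U" using g by (rule chart)
  let ?x = "vf_apply X1 \<phi> g" and ?y = "vf_apply X2 \<phi> g"
  have eq: "a * ?x + b * ?y = 0" "a' * ?x + b' * ?y = 0"
    using tangent_hor_iff S assms by blast+
  have "(a * b' - a' * b) * ?x = 0" "(a * b' - a' * b) * ?y = 0"
    using eq by algebra+
  then show ?thesis
    using noncharacteristic_point[OF S(1) S(2) g noncharacteristic] by auto
qed

text \<open>The direction (0, 0) is allowed, so that scaling needs no condition on the factor;
  nontriviality is stated separately.\<close>

definition line_in :: "heis \<Rightarrow> real \<Rightarrow> real \<Rightarrow> bool" where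
  "line_in g a b \<longleftrightarrow> (\<forall>s. g + s *\<^sub>R hor g a b \<in> S)"

lemma line_in_base: "line_in g a b \<Longrightarrow> g \<in> S"
  unfolding line_in_def by (metis add.right_neutral scaleR_zero_left)

lemma line_in_shift: "line_in g a b \<Longrightarrow> line_in (g + s *\<^sub>R hor g a b) a b"
  unfolding line_in_def hor_along_line
proof
  fix x assume "\<forall>s. g + s *\<^sub>R hor g a b \<in> S"
  then have "g + (s + x) *\<^sub>R hor g a b \<in> S" by blast
  then show "g + s *\<^sub>R hor g a b + x *\<^sub>R hor g a b \<in> S"
    by (simp add: scaleR_left_distrib add.assoc)
qed

lemma line_in_scale: "line_in g a b \<Longrightarrow> line_in g (c * a) (c * b)"
  unfolding line_in_def hor_scale by simp

lemma line_in_tangent: "line_in g a b \<Longrightarrow> tangent g (hor g a b)"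
proof -
  assume l: "line_in g a b"
  have "((\<lambda>s. g + s *\<^sub>R hor g a b) has_vector_derivative hor g a b) (at 0)"
    unfolding has_vector_derivative_def by (auto intro!: derivative_eq_intros)
  from tangent_curve[OF this, of 1] l show ?thesis by (simp add: line_in_def)
qed

lemma line_in_unique:
  assumes "line_in g a b" "line_in g a' b'"
  shows "a * b' = a' * b"
  using assms line_in_tangent line_in_base tangent_hor_unique by blast

lemma line_in_parallel:
  assumes l: "line_in g a b" and nz: "(a, b) \<noteq> (0, 0)" and p: "a * b' = a' * b"
  shows "line_in g a' b'"
proof -
  have "\<exists>c. a' = c * a \<and> b' = c * b"
  proof (cases "a = 0")
    case True
    then show ?thesis using nz p by (intro exI[of _ "b' / b"]) auto
  next
    case False
    then show ?thesis using p by (intro exI[of _ "a' / a"]) (auto simp: field_simps)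
  qed
  then show ?thesis using line_in_scale[OF l] by blast
qed

lemma tangent_segment:
  assumes g: "g \<in> S" and t: "tangent g (hor g a b)"
  shows "\<exists>\<epsilon>>0. \<forall>s. \<bar>s\<bar> < \<epsilon> \<longrightarrow> g + s *\<^sub>R hor g a b \<in> S"
proof -
  obtain U \<phi> where S: "C2_defining_function S U \<phi>" "g \<in> U" using g by (rule chart)
  let ?x = "vf_apply X1 \<phi> g" and ?y = "vf_apply X2 \<phi> g"
  have nz: "?x \<noteq> 0 \<or> ?y \<noteq> 0"
    by (rule noncharacteristic_point[OF S(1) S(2) g noncharacteristic])
  have "\<exists>\<epsilon>>0. \<forall>s. \<bar>s\<bar> < \<epsilon> \<longrightarrow> g + s *\<^sub>R hor g ?y (- ?x) \<in> S"
    using horizontal_segment[OF S g] noncharacteristic_point[OF S(1) _ _ noncharacteristic]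
      minimal S(1) unfolding H_minimal_def by blast
  then obtain \<epsilon> where \<epsilon>: "\<epsilon> > 0" "\<And>s. \<bar>s\<bar> < \<epsilon> \<Longrightarrow> g + s *\<^sub>R hor g ?y (- ?x) \<in> S" by blast
  have eq: "a * ?x + b * ?y = 0" using tangent_hor_iff S g t by blast
  have "\<exists>c. a = c * ?y \<and> b = c * - ?x"
  proof (cases "?y = 0")
    case True
    then show ?thesis using nz eq by (intro exI[of _ "- b / ?x"]) auto
  next
    case False
    then show ?thesis using eq by (intro exI[of _ "a / ?y"]) (auto simp: field_simps eq_neg_iff_add_eq_0)
  qed
  then obtain c where "a = c * ?y" "b = c * - ?x" by blast
  then have h: "hor g a b = c *\<^sub>R hor g ?y (- ?x)" using hor_scale by metis
  \<comment> \<open>The factor \<open>c\<close> may be 0, hence \<open>\<bar>c\<bar> + 1\<close> in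
    the denominator.\<close>
  have "g + s *\<^sub>R hor g a b \<in> S" if "\<bar>s\<bar> < \<epsilon> / (\<bar>c\<bar> + 1)" for s
  proof -
    have "\<bar>s * c\<bar> \<le> \<bar>s\<bar> * (\<bar>c\<bar> + 1)" by (simp add: abs_mult algebra_simps)
    also have "\<dots> < \<epsilon>" using that by (simp add: pos_less_divide_eq add_nonneg_pos)
    finally show ?thesis using \<epsilon>(2)[of "s * c"] by (simp add: h)
  qed
  then show ?thesis using \<epsilon>(1) by (intro exI[of _ "\<epsilon> / (\<bar>c\<bar> + 1)"]) (auto simp: add_nonneg_pos)
qed

text \<open>A clopen argument on the interior of \<open>C\<close>, not on \<open>C\<close> itself:
  at an isolated point of \<open>C\<close> the line need not be tangent to S. At a limit point of
  the interior, closedness of S gives membership, accumulation gives tangency, and tangency gives a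
  whole segment.\<close>

lemma tangent_imp_line_in:
  assumes g: "g \<in> S" and t: "tangent g (hor g a b)"
  shows "line_in g a b"
proof -
  define V where "V = hor g a b"
  define C where "C = {s. g + s *\<^sub>R V \<in> S}"
  have seg: "s \<in> interior C" if s: "s \<in> C" "tangent (g + s *\<^sub>R V) V" for s
  proof -
    have h: "hor (g + s *\<^sub>R V) a b = V" by (simp add: V_def hor_along_line)
    obtain \<epsilon> where \<epsilon>: "\<epsilon> > 0" "\<And>x. \<bar>x\<bar> < \<epsilon> \<Longrightarrow> g + s *\<^sub>R V + x *\<^sub>R V \<in> S"
      using tangent_segment[of "g + s *\<^sub>R V" a b] s by (auto simp: h C_def)
    have "ball s \<epsilon> \<subseteq> C"
    proof
      fix x assume "x \<in> ball s \<epsilon>"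
      then have "g + s *\<^sub>R V + (x - s) *\<^sub>R V \<in> S" by (intro \<epsilon>) (auto simp: dist_real_def)
      then show "x \<in> C" by (simp add: C_def algebra_simps)
    qed
    then show ?thesis using \<epsilon>(1) by (meson centre_in_ball interior_maximal open_ball subsetD)
  qed
  have "C = (\<lambda>s. g + s *\<^sub>R V) -` S" by (auto simp: C_def)
  then have "closed C" using closed_S by (auto intro!: closed_vimage continuous_intros)
  have "closure (interior C) \<subseteq> interior C"
  proof
    fix s assume s: "s \<in> closure (interior C)"
    have "s \<in> C" using s \<open>closed C\<close> closure_minimal interior_subset by blast
    show "s \<in> interior C"
    proof (cases "s \<in> interior C")
      case False
      then have "s islimpt interior C" using s by (simp add: closure_def)
      then have "s islimpt C" using interior_subset islimpt_subset by blast
      then have "frequently (\<lambda>x. x \<in> C) (at s)" by (simp add: islimpt_conv_frequently_at)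
      moreover have "((\<lambda>s. g + s *\<^sub>R V) has_vector_derivative V) (at s)"
        unfolding has_vector_derivative_def by (auto intro!: derivative_eq_intros)
      ultimately have "tangent (g + s *\<^sub>R V) V"
        using tangentI[of "\<lambda>s. g + s *\<^sub>R V" V s] \<open>s \<in> C\<close> by (simp add: C_def)
      then show ?thesis using seg \<open>s \<in> C\<close> by blast
    qed
  qed
  then have "closed (interior C)" using closure_subset_eq by blast
  moreover have "0 \<in> interior C" using seg[of 0] g t by (simp add: C_def V_def)
  ultimately have "interior C = UNIV" using clopen[of "interior C"] by auto
  then have "C = UNIV" using interior_subset by blast
  then show ?thesis by (auto simp: line_in_def C_def V_def)
qed

lemma ex_line_in:
  assumes g: "g \<in> S"
  obtains a b where "line_in g a b" "(a, b) \<noteq> (0, 0)"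
proof -
  obtain U \<phi> where S: "C2_defining_function S U \<phi>" "g \<in> U" using g by (rule chart)
  let ?x = "vf_apply X1 \<phi> g" and ?y = "vf_apply X2 \<phi> g"
  have nz: "?x \<noteq> 0 \<or> ?y \<noteq> 0"
    by (rule noncharacteristic_point[OF S(1) S(2) g noncharacteristic])
  obtain \<epsilon> where \<epsilon>: "\<epsilon> > 0" "\<And>s. \<bar>s\<bar> < \<epsilon> \<Longrightarrow> g + s *\<^sub>R hor g ?y (- ?x) \<in> S"
    using horizontal_segment[OF S g] noncharacteristic_point[OF S(1) _ _ noncharacteristic]
      minimal S(1) unfolding H_minimal_def by blast
  have "((\<lambda>s. g + s *\<^sub>R hor g ?y (- ?x)) has_vector_derivative hor g ?y (- ?x)) (at 0)"
    unfolding has_vector_derivative_def by (auto intro!: derivative_eq_intros)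
  from tangent_curve[OF this \<epsilon>(1)] \<epsilon>(2) have "tangent g (hor g ?y (- ?x))" by simp
  then have "line_in g ?y (- ?x)" using tangent_imp_line_in g by blast
  moreover have "(?y, - ?x) \<noteq> (0, 0)" using nz by auto
  ultimately show thesis by (rule that)
qed

end

subsection \<open>The common axis of the lines\<close>

definition det3 :: "heis \<Rightarrow> heis \<Rightarrow> heis \<Rightarrow> real" where
  "det3 = (\<lambda>(u1, u2, u3) (v1, v2, v3) (w1, w2, w3).
     u1 * (v2 * w3 - v3 * w2) - u2 * (v1 * w3 - v3 * w1) + u3 * (v1 * w2 - v2 * w1))"

lemma cramer3: "det3 u v w *\<^sub>R x = det3 x v w *\<^sub>R u + det3 u x w *\<^sub>R v + det3 u v x *\<^sub>R w"
  by (cases u; cases v; cases w; cases x) (simp add: det3_def algebra_simps)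

lemma det3_solve:
  assumes "det3 u v w \<noteq> 0"
  obtains a b c where "x = a *\<^sub>R u + b *\<^sub>R v + c *\<^sub>R w"
proof
  have "x = (1 / det3 u v w) *\<^sub>R (det3 u v w *\<^sub>R x)" using assms by simp
  then show "x = (det3 x v w / det3 u v w) *\<^sub>R u + (det3 u x w / det3 u v w) *\<^sub>R v
      + (det3 u v x / det3 u v w) *\<^sub>R w"
    unfolding cramer3[of u v w x] by (simp add: scaleR_right_distrib)
qed

text \<open>Both vectors lie in the one horizontal plane at g, so only the planar determinant of
  their coordinates can vary.\<close>

lemma det3_hor: "det3 (hor g a b) (hor g a' b') w = (a * b' - a' * b) * det3 (X1 g) (X2 g) w"
  by (cases g; cases w) (simp add: det3_def hor_Pair X1_def X2_def field_simps)

context minimal_graph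
begin

text \<open>Two lines of \<open>S\<close> whose directions were independent modulo \<open>n\<close> would have
  intersecting projections along \<open>n\<close>, hence a common point, with two different tangent
  horizontal directions there.\<close>

lemma directions_dependent:
  assumes l1: "line_in g a b" and l2: "line_in g' a' b'"
  shows "det3 (hor g a b) (hor g' a' b') n = 0"
proof (rule ccontr)
  assume nz: "det3 (hor g a b) (hor g' a' b') n \<noteq> 0"
  \<comment> \<open>Moving by \<open>r\<close> on the first line and by \<open>- r'\<close> on the
    second leads to two points of S that differ by a multiple of n, hence to the same point.\<close>
  then obtain r r' s where eq: "g' - g = r *\<^sub>R hor g a b + r' *\<^sub>R hor g' a' b' + s *\<^sub>R n"
    using det3_solve by blast
  define p where "p = g + r *\<^sub>R hor g a b"
  define p' where "p' = g' + (- r') *\<^sub>R hor g' a' b'"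
  have p: "line_in p a b" "line_in p' a' b'"
    using line_in_shift l1 l2 by (auto simp: p_def p'_def simp del: scaleR_minus_left)
  have "p' = p + s *\<^sub>R n" using eq by (simp add: p_def p'_def algebra_simps)
  moreover have "s = 0" using graph_unique[of p s] line_in_base p calculation by simp
  ultimately have "p' = p" by simp
  then have "a * b' = a' * b" using line_in_unique p by blast
  moreover have "hor g a b = hor p a b" "hor g' a' b' = hor p a' b'"
    using \<open>p' = p\<close> hor_along_line by (metis p_def, metis p'_def)
  ultimately show False using det3_hor[of p a b a' b' n] nz by simp
qed

lemma not_line_along_n:
  assumes "line_in g a b" "hor g a b = c *\<^sub>R n"
  shows "(a, b) = (0, 0)"
proof -
  have "g + c *\<^sub>R n \<in> S" using assms unfolding line_in_def by (metis scaleR_one)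
  then have "c = 0" using graph_unique line_in_base assms by blast
  then show ?thesis using assms by (cases g) (simp add: hor_Pair zero_prod_def)
qed

text \<open>Over a vertical \<open>n\<close> all lines would project to parallel lines. Moving along a line then
  tilts the tangent plane monotonically, so it becomes horizontal somewhere unless it is
  vertical everywhere; in the latter case \<open>S\<close> would contain vertical segments.\<close>

lemma parallel_lines_vertical_tangent:
  assumes d: "(d1, d2) \<noteq> (0, 0)" and lines: "\<And>g. g \<in> S \<Longrightarrow> line_in g d1 d2"
    and p: "p \<in> S"
  shows "tangent p (0, 0, 1)"
  unfolding tangent_def
proof (intro allI impI, rule ccontr)
  fix U \<phi> assume S: "C2_defining_function S U \<phi>" and pU: "p \<in> U"
  let ?D = "\<lambda>p. frechet_derivative \<phi> (at p)"
  let ?T = "(0, 0, 1) :: heis"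
  assume T: "?D p ?T \<noteq> 0"
  note D = defining_functionD[OF S]
  define N where "N = d1\<^sup>2 + d2\<^sup>2"
  have N: "N \<noteq> 0" using d by (auto simp: N_def sum_power2_eq_zero_iff)
  define e :: heis where "e = (- d2, d1, 0)"
  have \<phi>p: "\<phi> p = 0" using D(4) pU p by blast
  obtain r \<delta> where r: "r > 0" and \<delta>0: "\<delta> 0 = 0"
    and \<delta>: "\<forall>s. \<bar>s\<bar> < r \<longrightarrow> p + s *\<^sub>R e + \<delta> s *\<^sub>R ?T \<in> U \<and> \<phi> (p + s *\<^sub>R e + \<delta> s *\<^sub>R ?T) = 0 \<and>
       ?D (p + s *\<^sub>R e + \<delta> s *\<^sub>R ?T) ?T \<noteq> 0"
    and \<delta>': "\<forall>s. \<bar>s\<bar> < r \<longrightarrow> (\<delta> has_real_derivative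
       - ?D (p + s *\<^sub>R e + \<delta> s *\<^sub>R ?T) e / ?D (p + s *\<^sub>R e + \<delta> s *\<^sub>R ?T) ?T) (at s)"
    using C1_implicit_curve[OF D(2,1) pU \<phi>p T, of e] by blast
  obtain k where k: "(\<delta> has_real_derivative k) (at 0)" using \<delta>' r by force
  obtain x y t where xyt: "p = (x, y, t)" by (cases p) auto
  \<comment> \<open>\<open>C\<close> transports the transverse curve
    \<open>p + s e + \<delta> T\<close> by the parameter \<open>R\<close> along the line through
    each of its points. Its velocity at 0 is \<open>(- d2, d1, k - R N / 2)\<close>, while a
    horizontal vector there needs third entry \<open>(x d1 + y d2 + R N) / 2\<close>;
    \<open>R\<close> makes the two equal.\<close>
  define R where "R = (k - (x * d1 + y * d2) / 2) / N"
  define C where "C = (\<lambda>s. (x - s * d2 + R * d1, y + s * d1 + R * d2,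
     t + \<delta> s + R * (((x - s * d2) * d2 - (y + s * d1) * d1) / 2)))"
  have C: "C s \<in> S" if "\<bar>s\<bar> < r" for s
  proof -
    have "p + s *\<^sub>R e + \<delta> s *\<^sub>R ?T \<in> S" using \<delta> that D(4) by blast
    then have "p + s *\<^sub>R e + \<delta> s *\<^sub>R ?T + R *\<^sub>R hor (p + s *\<^sub>R e + \<delta> s *\<^sub>R ?T) d1 d2 \<in> S"
      using lines unfolding line_in_def by blast
    then show ?thesis by (simp add: xyt e_def C_def hor_Pair)
  qed
  have "(C has_vector_derivative (- d2, d1, k - R * N / 2)) (at 0)"
    unfolding C_def has_vector_derivative_def N_def
    by (auto intro!: derivative_eq_intros k[unfolded has_field_derivative_def]
        simp: fun_eq_iff field_simps power2_eq_square)
  then have "tangent (C 0) (- d2, d1, k - R * N / 2)"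
    using tangent_curve[OF _ r] C by simp
  moreover have "hor (C 0) (- d2) d1 = (- d2, d1, k - R * N / 2)"
  proof -
    have "R * N = k - (x * d1 + y * d2) / 2" using N by (simp add: R_def)
    then show ?thesis by (simp add: C_def hor_Pair N_def field_simps power2_eq_square)
  qed
  ultimately have "tangent (C 0) (hor (C 0) (- d2) d1)" by simp
  moreover have "C 0 \<in> S" using C r by simp
  moreover have "tangent (C 0) (hor (C 0) d1 d2)" using line_in_tangent lines \<open>C 0 \<in> S\<close> by blast
  ultimately have "- d2 * d2 = d1 * d1" using tangent_hor_unique by blast
  then have "d1 * d1 + d2 * d2 = 0" by linarith
  then show False using N by (simp add: N_def power2_eq_square)
qed

lemma n_not_vertical: "(fst n, fst (snd n)) \<noteq> (0, 0)"
proof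
  assume "(fst n, fst (snd n)) = (0, 0)"
  then obtain c where n: "n = (0, 0, c)" by (cases n) auto
  then have c: "c \<noteq> 0" using n_nonzero by (auto simp: zero_prod_def)
  define p where "p = foot 0"
  have p: "p \<in> S" using foot_in p_def by simp
  then obtain d1 d2 where l: "line_in p d1 d2" and d: "(d1, d2) \<noteq> (0, 0)" by (rule ex_line_in)
  have lines: "line_in g d1 d2" if gS: "g \<in> S" for g
  proof -
    obtain a b where ab: "line_in g a b" "(a, b) \<noteq> (0, 0)" by (rule ex_line_in[OF gS])
    have "det3 (hor g a b) (hor p d1 d2) n = 0" using directions_dependent ab l by blast
    \<comment> \<open>Modulo a vertical n only the planar determinant of the two directions
      survives.\<close>
    then have "a * d2 = d1 * b" using c by (cases g; cases p) (simp add: n det3_def hor_Pair)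
    then show ?thesis using line_in_parallel ab by blast
  qed
  have vert: "tangent q (0, 0, 1)" if "q \<in> S" for q
    by (rule parallel_lines_vertical_tangent[OF d _ that]) (rule lines)
  let ?T = "(0, 0, 1) :: heis"
  obtain U \<phi> where S: "C2_defining_function S U \<phi>" and pU: "p \<in> U" using p by (rule chart)
  let ?D = "\<lambda>p. frechet_derivative \<phi> (at p)"
  note D = defining_functionD[OF S]
  define w where "w = hor p (- d2) d1"
  have "det3 (hor p d1 d2) w ?T = d1 * d1 + d2 * d2"
    by (cases p) (simp add: w_def det3_def hor_Pair)
  then have det: "det3 (hor p d1 d2) w ?T \<noteq> 0" using d by (auto simp: sum_squares_eq_zero_iff)
  have w: "?D p w \<noteq> 0"
  proof
    assume 0: "?D p w = 0"
    obtain v where v: "?D p v \<noteq> 0" using S pU unfolding C2_defining_function_def by blast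
    obtain a b c where "v = a *\<^sub>R hor p d1 d2 + b *\<^sub>R w + c *\<^sub>R ?T" using det3_solve det by blast
    then have "?D p v = a * ?D p (hor p d1 d2) + b * ?D p w + c * ?D p ?T"
      by (simp only: linear_add[OF D(6)[OF pU]] linear_cmul[OF D(6)[OF pU]] real_scaleR_def)
    moreover have "?D p (hor p d1 d2) = 0" "?D p ?T = 0"
      using line_in_tangent[OF l] vert[OF p] S pU unfolding tangent_def by blast+
    ultimately show False using v 0 by simp
  qed
  have \<phi>p: "\<phi> p = 0" using D(4) pU p by blast
  obtain r \<delta> where r: "r > 0" and \<delta>0: "\<delta> 0 = 0"
    and \<delta>: "\<forall>s. \<bar>s\<bar> < r \<longrightarrow> p + s *\<^sub>R ?T + \<delta> s *\<^sub>R w \<in> U \<and> \<phi> (p + s *\<^sub>R ?T + \<delta> s *\<^sub>R w) = 0 \<and>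
       ?D (p + s *\<^sub>R ?T + \<delta> s *\<^sub>R w) w \<noteq> 0"
    and \<delta>': "\<forall>s. \<bar>s\<bar> < r \<longrightarrow> (\<delta> has_real_derivative
       - ?D (p + s *\<^sub>R ?T + \<delta> s *\<^sub>R w) ?T / ?D (p + s *\<^sub>R ?T + \<delta> s *\<^sub>R w) w) (at s)"
    using C1_implicit_curve[OF D(2,1) pU \<phi>p w, of ?T] by blast
  have inS: "p + s *\<^sub>R ?T + \<delta> s *\<^sub>R w \<in> S" if "\<bar>s\<bar> < r" for s
    using \<delta> that D(4) by blast
  have "(\<delta> has_real_derivative 0) (at s)" if s: "\<bar>s\<bar> < r" for s
  proof -
    have "?D (p + s *\<^sub>R ?T + \<delta> s *\<^sub>R w) ?T = 0"
      using vert[OF inS[OF s]] S \<delta> s unfolding tangent_def by blast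
    then show ?thesis using \<delta>' s by fastforce
  qed
  \<comment> \<open>As \<open>?T\<close> is tangent all along, the curve following the vertical
    direction never deviates, and S contains a segment parallel to n.\<close>
  then have "\<delta> (r / 2) = \<delta> 0"
    using r by (intro DERIV_isconst3[of "- r" r "r / 2" 0 \<delta>]) auto
  then have "p + (r / 2) *\<^sub>R ?T \<in> S" using inS[of "r / 2"] \<delta>0 r by simp
  moreover have "(r / 2) *\<^sub>R ?T = (r / 2 / c) *\<^sub>R n" using c by (simp add: n)
  ultimately have "r / 2 / c = 0" using graph_unique[OF p] by metis
  then show False using r c by simp
qed

text \<open>Along the points where the horizontal plane contains \<open>n\<close>, the line of \<open>S\<close> is not
  parallel to \<open>n\<close>, so \<open>n\<close> and its direction span a non-vertical plane, to which all lines of \<open>S\<close>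
  are parallel. The points where the horizontal plane is that plane form the axis.\<close>

lemma ex_axis:
  "\<exists>x0 y0. \<forall>g a b. line_in g a b \<longrightarrow> a * (fst (snd g) - y0) = b * (fst g - x0)"
proof -
  obtain n1 n2 n3 where n: "n = (n1, n2, n3)" by (cases n) auto
  define N where "N = n1\<^sup>2 + n2\<^sup>2"
  have N: "N \<noteq> 0" using n_not_vertical by (auto simp: N_def n sum_power2_eq_zero_iff)
  \<comment> \<open>A horizontal vector with planar part \<open>(n1, n2)\<close> equals n where
    \<open>x n2 - y n1 = 2 n3\<close>. The chosen point satisfies this, and passing to its
    \<open>foot\<close> keeps it true because motion along n does not change the left side.\<close>
  obtain x y t where foot: "foot (2 * n3 * n2 / N, - 2 * n3 * n1 / N, 0) = (x, y, t)"
    by (metis prod.collapse)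
  let ?g = "(x, y, t)"
  obtain s where "?g = (2 * n3 * n2 / N, - 2 * n3 * n1 / N, 0) + s *\<^sub>R n"
    using foot_decompose foot by metis
  then have xy: "x = 2 * n3 * n2 / N + s * n1" "y = - 2 * n3 * n1 / N + s * n2" by (auto simp: n)
  have "x * n2 - y * n1 = 2 * n3 * N / N"
    unfolding xy N_def by (simp add: add_divide_distrib algebra_simps power2_eq_square)
  then have hn: "hor ?g n1 n2 = n" using N by (simp add: n hor_Pair)
  have "?g \<in> S" using foot_in foot by metis
  then obtain a b where l: "line_in ?g a b" and ab: "(a, b) \<noteq> (0, 0)" by (rule ex_line_in)
  \<comment> \<open>\<open>(m1, m2, m3)\<close> is the cross product of the line direction with n, a
    normal of the plane they span; \<open>m3 \<noteq> 0\<close> says that this plane is not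
    vertical.\<close>
  define m3 where "m3 = a * n2 - b * n1"
  have m3: "m3 \<noteq> 0"
  proof
    assume "m3 = 0"
    then have "line_in ?g n1 n2" using line_in_parallel[OF l ab] by (simp add: m3_def mult.commute)
    then have "(n1, n2) = (0, 0)" using not_line_along_n[of ?g n1 n2 1] hn by simp
    then show False using n_not_vertical n by simp
  qed
  define v3 where "v3 = (x * b - y * a) / 2"
  define m1 where "m1 = b * n3 - v3 * n2"
  define m2 where "m2 = v3 * n1 - a * n3"
  \<comment> \<open>The point over which the horizontal plane, with normal (y0/2, - x0/2, 1), is
    parallel to the plane with normal \<open>(m1, m2, m3)\<close>.\<close>
  define x0 where "x0 = - 2 * m2 / m3"
  define y0 where "y0 = 2 * m1 / m3"
  have m: "m2 = - x0 * m3 / 2" "m1 = y0 * m3 / 2" using m3 by (auto simp: x0_def y0_def)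
  show ?thesis
  proof (intro exI allI impI)
    fix g' a' b' assume l': "line_in g' a' b'"
    obtain x' y' t' where g': "g' = (x', y', t')" by (cases g') auto
    have "det3 (hor g' a' b') (hor ?g a b) n = 0" using directions_dependent[OF l' l] .
    moreover have "det3 (hor g' a' b') (hor ?g a b) n = a' * m1 + b' * m2 + (x' * b' - y' * a') / 2 * m3"
      unfolding m1_def m2_def m3_def v3_def
      by (simp add: g' n hor_Pair det3_def field_simps)
    ultimately have "2 * (a' * m1 + b' * m2) + (x' * b' - y' * a') * m3 = 0" by simp
    moreover have "2 * m1 = y0 * m3" "2 * m2 = - x0 * m3" using m by simp_all
    ultimately have "m3 * (a' * (y' - y0) - b' * (x' - x0)) = 0" by algebra
    then show "a' * (fst (snd g') - y0) = b' * (fst g' - x0)" using m3 by (simp add: g')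
  qed
qed

end

subsection \<open>Strips around the axis\<close>

text \<open>The left translate of \<open>(a, b, t)\<close> by \<open>(x0, y0, 0)\<close>.\<close>

definition axis_pt :: "real \<Rightarrow> real \<Rightarrow> real \<Rightarrow> real \<Rightarrow> real \<Rightarrow> heis" where
  "axis_pt x0 y0 a b t = (x0 + a, y0 + b, t + (x0 * b - y0 * a) / 2)"

text \<open>The axis is the vertical line over \<open>(x0, y0)\<close>; the assumption says that the
  planar projection of every nondegenerate line in S passes through that point.\<close>

locale axial_minimal_graph = minimal_graph +
  fixes x0 y0 :: real
  assumes axis: "line_in g a b \<Longrightarrow> a * (fst (snd g) - y0) = b * (fst g - x0)"
begin

abbreviation pt :: "real \<Rightarrow> real \<Rightarrow> real \<Rightarrow> heis" where
  "pt \<equiv> axis_pt x0 y0"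

text \<open>The t-coordinate after left translation by \<open>(- x0, - y0, 0)\<close>; horizontal
  motion along a line through the axis preserves it.\<close>

definition ht :: "heis \<Rightarrow> real" where
  "ht g = snd (snd g) - (x0 * fst (snd g) - y0 * fst g) / 2"

lemma ht_pt [simp]: "ht (pt a b t) = t"
  by (simp add: ht_def axis_pt_def field_simps)

lemma pt_ht: "pt (fst g - x0) (fst (snd g) - y0) (ht g) = g"
  by (cases g) (simp add: ht_def axis_pt_def field_simps)

lemma hor_pt: "hor (pt a b t) p q = hor (pt 0 0 t') p q + (0, 0, (a * q - b * p) / 2)"
  by (simp add: axis_pt_def hor_Pair field_simps)

lemma pt_add: "pt a b t + s *\<^sub>R hor (pt a b t) (r * a) (r * b) = pt ((1 + s * r) * a) ((1 + s * r) * b) t"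
  by (simp add: axis_pt_def hor_Pair field_simps)

lemma continuous_on_ht: "continuous_on A ht"
  unfolding ht_def by (intro continuous_intros) simp

text \<open>Off the axis, the axis condition forces the line through the point to be radial, and
  radial horizontal motion keeps the translated height.\<close>

lemma pt_scale:
  assumes "pt a b t \<in> S"
  shows "pt (s * a) (s * b) t \<in> S"
proof (cases "a = 0 \<and> b = 0")
  case True
  then show ?thesis using assms by auto
next
  case False
  obtain p q where l: "line_in (pt a b t) p q" "(p, q) \<noteq> (0, 0)" by (rule ex_line_in[OF assms])
  have "p * b = a * q" using axis[OF l(1)] by (simp add: axis_pt_def mult.commute)
  then have "line_in (pt a b t) (1 * a) (1 * b)" using line_in_parallel l by simp
  then have "pt a b t + (s - 1) *\<^sub>R hor (pt a b t) (1 * a) (1 * b) \<in> S"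
    unfolding line_in_def by blast
  then show ?thesis unfolding pt_add by simp
qed

lemma pt_axis: "pt a b t \<in> S \<Longrightarrow> pt 0 0 t \<in> S"
  using pt_scale[of a b t 0] by simp

lemma line_in_pt:
  assumes "pt a b t \<in> S"
  shows "line_in (pt 0 0 t) a b"
  unfolding line_in_def
proof
  fix s
  have "pt 0 0 t + s *\<^sub>R hor (pt 0 0 t) a b = pt (s * a) (s * b) t"
    by (simp add: axis_pt_def hor_Pair field_simps)
  then show "pt 0 0 t + s *\<^sub>R hor (pt 0 0 t) a b \<in> S" using pt_scale[OF assms] by simp
qed

text \<open>Both points lie on lines of S through the same axis point, and these lines
  coincide.\<close>

lemma pt_parallel: "pt a b t \<in> S \<Longrightarrow> pt a' b' t \<in> S \<Longrightarrow> a * b' = a' * b"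
  using line_in_pt line_in_unique by blast

lemma ex_unit_direction:
  assumes "pt 0 0 t \<in> S"
  obtains d1 d2 where "d1\<^sup>2 + d2\<^sup>2 = 1" "pt d1 d2 t \<in> S"
proof -
  obtain a b where l: "line_in (pt 0 0 t) a b" and ab: "(a, b) \<noteq> (0, 0)" by (rule ex_line_in[OF assms])
  define N where "N = sqrt (a\<^sup>2 + b\<^sup>2)"
  have N: "N \<noteq> 0" "N\<^sup>2 = a\<^sup>2 + b\<^sup>2" using ab by (auto simp: N_def sum_power2_eq_zero_iff)
  have "pt 0 0 t + (1 / N) *\<^sub>R hor (pt 0 0 t) a b \<in> S" using l unfolding line_in_def by blast
  moreover have "pt 0 0 t + (1 / N) *\<^sub>R hor (pt 0 0 t) a b = pt (a / N) (b / N) t"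
    using N(1) by (simp add: axis_pt_def hor_Pair field_simps)
  ultimately have "pt (a / N) (b / N) t \<in> S" by simp
  moreover have "(a / N)\<^sup>2 + (b / N)\<^sup>2 = 1"
    using N(1) unfolding power_divide add_divide_distrib[symmetric] N(2)[symmetric] by simp
  ultimately show thesis using that by blast
qed

text \<open>For a unit vector \<open>(d1, d2)\<close>: coordinates about the axis, rotated so that
  this direction becomes the positive y-axis, as in the normal form of a strip.\<close>

definition rot_pt :: "real \<Rightarrow> real \<Rightarrow> real \<Rightarrow> real \<Rightarrow> real \<Rightarrow> heis" where
  "rot_pt d1 d2 x y t = pt (x * d2 + y * d1) (y * d2 - x * d1) t"

text \<open>The map is affine with constant vectors, so velocities of curves given in these
  coordinates can be read off.\<close>

lemma rot_pt_affine:
  "rot_pt d1 d2 x y t = pt 0 0 t' + x *\<^sub>R hor (pt 0 0 t') d2 (- d1) + y *\<^sub>R hor (pt 0 0 t') d1 d2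
     + (t - t') *\<^sub>R (0, 0, 1)"
  by (simp add: rot_pt_def axis_pt_def hor_Pair field_simps)

text \<open>In the rotated coordinates the horizontal frame again has the form of \<open>X1\<close>
  and \<open>X2\<close>, because rotations about the t-axis are group automorphisms.\<close>

lemma hor_rot_pt:
  assumes "d1\<^sup>2 + d2\<^sup>2 = 1"
  shows "hor (rot_pt d1 d2 x y t) d2 (- d1) = hor (pt 0 0 t') d2 (- d1) + (- y / 2) *\<^sub>R (0, 0, 1)"
    and "hor (rot_pt d1 d2 x y t) d1 d2 = hor (pt 0 0 t') d1 d2 + (x / 2) *\<^sub>R (0, 0, 1)"
proof -
  have 1: "(x * d2 + y * d1) * (- d1) - (y * d2 - x * d1) * d2 = - y * (d1\<^sup>2 + d2\<^sup>2)"
    "(x * d2 + y * d1) * d2 - (y * d2 - x * d1) * d1 = x * (d1\<^sup>2 + d2\<^sup>2)"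
    by (simp_all add: algebra_simps power2_eq_square)
  show "hor (rot_pt d1 d2 x y t) d2 (- d1) = hor (pt 0 0 t') d2 (- d1) + (- y / 2) *\<^sub>R (0, 0, 1)"
    unfolding rot_pt_def by (subst hor_pt[of _ _ _ _ _ t']) (simp only: 1 assms, simp)
  show "hor (rot_pt d1 d2 x y t) d1 d2 = hor (pt 0 0 t') d1 d2 + (x / 2) *\<^sub>R (0, 0, 1)"
    unfolding rot_pt_def by (subst hor_pt[of _ _ _ _ _ t']) (simp only: 1 assms, simp)
qed

lemma pt_eq_rot_pt:
  assumes "d1\<^sup>2 + d2\<^sup>2 = 1"
  shows "pt a b t = rot_pt d1 d2 (a * d2 - b * d1) (a * d1 + b * d2) t"
proof -
  have "(a * d2 - b * d1) * d2 + (a * d1 + b * d2) * d1 = a * (d1\<^sup>2 + d2\<^sup>2)"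
    "(a * d1 + b * d2) * d2 - (a * d2 - b * d1) * d1 = b * (d1\<^sup>2 + d2\<^sup>2)"
    by (simp_all add: algebra_simps power2_eq_square)
  then show ?thesis using assms by (simp add: rot_pt_def)
qed

lemma rot_pt_scale: "rot_pt d1 d2 x y t \<in> S \<Longrightarrow> rot_pt d1 d2 (s * x) (s * y) t \<in> S"
  using pt_scale[of "x * d2 + y * d1" "y * d2 - x * d1" t s]
  by (simp add: rot_pt_def algebra_simps)

lemma rot_pt_parallel:
  assumes d: "d1\<^sup>2 + d2\<^sup>2 = 1" and "rot_pt d1 d2 x y t \<in> S" "rot_pt d1 d2 x' y' t \<in> S"
  shows "x * y' = x' * y"
proof -
  have "(x * d2 + y * d1) * (y' * d2 - x' * d1) = (x' * d2 + y' * d1) * (y * d2 - x * d1)"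
    using pt_parallel assms(2,3) unfolding rot_pt_def by blast
  then have "(x * y' - x' * y) * (d1\<^sup>2 + d2\<^sup>2) = 0" by algebra
  then show ?thesis using d by simp
qed

text \<open>The graph function is read off where the lines have distance \<open>y1\<close> from the axis. The point
  must be off the axis to see the direction of the line, and close to it because only at the axis does
  \<open>d\<phi> \<noteq> 0\<close> on the horizontal direction orthogonal to the line follow at once.\<close>

lemma local_strip:
  assumes d: "d1\<^sup>2 + d2\<^sup>2 = 1" and S0: "pt d1 d2 t0 \<in> S"
  shows "\<exists>r G G'. r > 0 \<and>
    (\<forall>x y t. \<bar>t - t0\<bar> < r \<longrightarrow> (rot_pt d1 d2 x y t \<in> S \<longleftrightarrow> x = y * G t)) \<and>
    (\<forall>t. \<bar>t - t0\<bar> < r \<longrightarrow> (G has_real_derivative G' t) (at t)) \<and>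
    C1_on G' {t0 - r<..<t0 + r}"
proof -
  let ?T = "(0, 0, 1) :: heis"
  define A0 where "A0 = pt 0 0 t0"
  define Ev where "Ev = hor A0 d2 (- d1)"
  define Dv where "Dv = hor A0 d1 d2"
  have q: "rot_pt d1 d2 x y t = A0 + x *\<^sub>R Ev + y *\<^sub>R Dv + (t - t0) *\<^sub>R ?T" for x y t
    using rot_pt_affine unfolding A0_def Ev_def Dv_def .
  have A0: "A0 \<in> S" using pt_axis S0 by (simp add: A0_def)
  obtain U \<phi> where S: "C2_defining_function S U \<phi>" and A0U: "A0 \<in> U" using A0 by (rule chart)
  let ?D = "\<lambda>p. frechet_derivative \<phi> (at p)"
  note D = defining_functionD[OF S]
  have l: "line_in A0 d1 d2" using line_in_pt S0 by (simp add: A0_def)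
  have E0: "?D A0 Ev \<noteq> 0"
  proof
    assume "?D A0 Ev = 0"
    then have e: "d2 * ?D A0 (X1 A0) - d1 * ?D A0 (X2 A0) = 0"
      unfolding Ev_def linear_hor[OF D(6)[OF A0U]] by simp
    have "?D A0 Dv = 0" using line_in_tangent[OF l] S A0U unfolding tangent_def Dv_def by blast
    then have f: "d1 * ?D A0 (X1 A0) + d2 * ?D A0 (X2 A0) = 0"
      unfolding Dv_def linear_hor[OF D(6)[OF A0U]] by simp
    have "(d1\<^sup>2 + d2\<^sup>2) * ?D A0 (X1 A0) = 0" "(d1\<^sup>2 + d2\<^sup>2) * ?D A0 (X2 A0) = 0"
      using e f by algebra+
    then show False
      using noncharacteristic_point[OF S A0U A0 noncharacteristic] d by (simp add: vf_apply_def)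
  qed
  have "isCont (\<lambda>p. ?D p Ev) A0" using C1_on_isCont_derivative[OF D(2,1) A0U] .
  then have "eventually (\<lambda>p. ?D p Ev \<noteq> 0) (nhds A0)"
    using E0 tendsto_imp_eventually_ne[of "\<lambda>p. ?D p Ev" "?D A0 Ev" "nhds A0" 0]
      tendsto_at_iff_tendsto_nhds[of "\<lambda>p. ?D p Ev" A0]
    unfolding isCont_def by blast
  moreover have "eventually (\<lambda>p. p \<in> U) (nhds A0)" using eventually_nhds_in_open D(1) A0U by blast
  ultimately have ev: "eventually (\<lambda>p. ?D p Ev \<noteq> 0 \<and> p \<in> U) (nhds A0)" by (rule eventually_conj)
  have "isCont (\<lambda>y. A0 + y *\<^sub>R Dv) 0" by (intro continuous_intros)
  then have "filterlim (\<lambda>y. A0 + y *\<^sub>R Dv) (nhds A0) (at_right 0)"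
    unfolding isCont_def by (auto intro: filterlim_mono at_le)
  from filterlim_iff[THEN iffD1, OF this, rule_format, OF ev]
  have "eventually (\<lambda>y. ?D (A0 + y *\<^sub>R Dv) Ev \<noteq> 0 \<and> A0 + y *\<^sub>R Dv \<in> U) (at_right 0)" .
  then have "eventually (\<lambda>y::real. y > 0 \<and> ?D (A0 + y *\<^sub>R Dv) Ev \<noteq> 0 \<and> A0 + y *\<^sub>R Dv \<in> U) (at_right 0)"
    using eventually_at_right_less[of "0::real"] by eventually_elim auto
  then obtain y1 :: real where y1: "y1 > 0" "?D (A0 + y1 *\<^sub>R Dv) Ev \<noteq> 0" "A0 + y1 *\<^sub>R Dv \<in> U"
    using eventually_happens'[OF trivial_limit_at_right_real] by blast
  define g1 where "g1 = A0 + y1 *\<^sub>R Dv"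
  have g1U: "g1 \<in> U" and E1: "?D g1 Ev \<noteq> 0" using y1 by (simp_all add: g1_def)
  have "g1 \<in> S" using l unfolding line_in_def g1_def Dv_def by blast
  then have \<phi>g1: "\<phi> g1 = 0" using D(4) g1U by blast
  obtain r \<xi> where r: "r > 0" and "\<xi> 0 = 0"
    and \<xi>: "\<forall>s. \<bar>s\<bar> < r \<longrightarrow> g1 + s *\<^sub>R ?T + \<xi> s *\<^sub>R Ev \<in> U \<and> \<phi> (g1 + s *\<^sub>R ?T + \<xi> s *\<^sub>R Ev) = 0 \<and>
       ?D (g1 + s *\<^sub>R ?T + \<xi> s *\<^sub>R Ev) Ev \<noteq> 0"
    and \<xi>': "\<forall>s. \<bar>s\<bar> < r \<longrightarrow> (\<xi> has_real_derivative
       - ?D (g1 + s *\<^sub>R ?T + \<xi> s *\<^sub>R Ev) ?T / ?D (g1 + s *\<^sub>R ?T + \<xi> s *\<^sub>R Ev) Ev) (at s)"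
    using C1_implicit_curve[OF D(2,1) g1U \<phi>g1 E1, of ?T] by blast
  define I where "I = {t0 - r<..<t0 + r}"
  have I: "t \<in> I \<longleftrightarrow> \<bar>t - t0\<bar> < r" for t by (auto simp: I_def)
  define c where "c = (\<lambda>t. g1 + (t - t0) *\<^sub>R ?T + \<xi> (t - t0) *\<^sub>R Ev)"
  define k where "k = (\<lambda>t. - ?D (c t) ?T / ?D (c t) Ev)"
  have c: "c t \<in> U" "c t \<in> S" "?D (c t) Ev \<noteq> 0" if "t \<in> I" for t
    using \<xi> that D(4) unfolding I c_def by blast+
  have d\<xi>: "((\<lambda>t. \<xi> (t - t0)) has_real_derivative k t) (at t)" if "t \<in> I" for t
  proof -
    have "(\<xi> has_real_derivative k t) (at (t - t0))"
      using \<xi>' that unfolding I k_def c_def by blast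
    moreover have "((\<lambda>t. t - t0) has_real_derivative 1) (at t)"
      by (auto intro!: derivative_eq_intros)
    ultimately show ?thesis
      using DERIV_chain2[where f=\<xi> and g="\<lambda>t. t - t0" and Da="k t" and Db=1 and x=t] by simp
  qed
  have dc: "(c has_vector_derivative ?T + k t *\<^sub>R Ev) (at t)" if "t \<in> I" for t
    using d\<xi>[OF that] unfolding c_def has_vector_derivative_def has_field_derivative_def
    by (auto intro!: derivative_eq_intros simp: algebra_simps)
  have "open I" by (simp add: I_def)
  have "continuous_on I c"
    using dc by (meson continuous_at_imp_continuous_on has_vector_derivative_continuous)
  then have "continuous_on I (\<lambda>t. ?D (c t) v)" for v
    using c(1) by (intro continuous_on_frechet_derivative_apply[OF D(2)] continuous_intros) auto
  then have contk: "continuous_on I k" unfolding k_def using c(3) by (intro continuous_intros) auto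
  \<comment> \<open>A bootstrap: continuity of \<open>k\<close> makes \<open>c\<close> a C1 curve;
    the partial derivatives of \<open>\<phi>\<close> are C1, hence C1 along \<open>c\<close>, and so
    \<open>k\<close> is C1. This gives the second derivative of the graph function.\<close>
  have C1D: "C1_on (\<lambda>t. ?D (c t) v) I" for v
    by (rule C1_on_compose_curve[OF D(3) \<open>open I\<close> c(1) dc]) (auto intro!: continuous_intros contk)
  have "C1_on k I"
    using C1_on_divide[OF C1_on_diff[OF C1_on_const[OF \<open>open I\<close>, of 0] C1D \<open>open I\<close>] C1D \<open>open I\<close> c(3)]
    unfolding k_def by simp
  then have C1k: "C1_on (\<lambda>t. k t / y1) I"
    using C1_on_divide[OF _ C1_on_const[OF \<open>open I\<close>, of y1] \<open>open I\<close>] y1(1) by simp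
  have cq: "rot_pt d1 d2 (\<xi> (t - t0)) y1 t = c t" for t
    by (simp add: q c_def g1_def)
  show ?thesis
  proof (rule exI[of _ r], rule exI[of _ "\<lambda>t. \<xi> (t - t0) / y1"], rule exI[of _ "\<lambda>t. k t / y1"],
      intro conjI allI impI r)
    fix x y t assume "\<bar>t - t0\<bar> < r"
    then have cS: "rot_pt d1 d2 (\<xi> (t - t0)) y1 t \<in> S"
      unfolding cq by (intro c(2)) (simp add: I)
    show "rot_pt d1 d2 x y t \<in> S \<longleftrightarrow> x = y * (\<xi> (t - t0) / y1)"
    proof
      assume "rot_pt d1 d2 x y t \<in> S"
      then have "x * y1 = \<xi> (t - t0) * y" using rot_pt_parallel[OF d _ cS] by blast
      then show "x = y * (\<xi> (t - t0) / y1)" using y1(1) by (simp add: field_simps)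
    next
      assume "x = y * (\<xi> (t - t0) / y1)"
      then show "rot_pt d1 d2 x y t \<in> S" using rot_pt_scale[OF cS, of "y / y1"] y1(1) by simp
    qed
  next
    fix t assume "\<bar>t - t0\<bar> < r"
    then show "((\<lambda>t. \<xi> (t - t0) / y1) has_real_derivative k t / y1) (at t)"
      using d\<xi> I by (intro DERIV_cdivide) blast
  next
    show "C1_on (\<lambda>t. k t / y1) {t0 - r<..<t0 + r}" using C1k by (simp add: I_def)
  qed
qed

text \<open>If \<open>G'\<close> were negative, the tangent plane at distance \<open>y\<close> from the axis, where
  \<open>1 + y\<^sup>2 G' / 2 = 0\<close>, would be horizontal.\<close>

lemma strip_derivative_nonneg:
  assumes d: "d1\<^sup>2 + d2\<^sup>2 = 1"
    and iff: "\<And>x y t. \<bar>t - t0\<bar> < r \<Longrightarrow> rot_pt d1 d2 x y t \<in> S \<longleftrightarrow> x = y * G t"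
    and G: "(G has_real_derivative G') (at t)" and t: "\<bar>t - t0\<bar> < r"
  shows "G' \<ge> 0"
proof (rule ccontr)
  assume "\<not> G' \<ge> 0"
  then have neg: "- 2 / G' > 0" by (simp add: zero_less_divide_iff)
  define y where "y = sqrt (- 2 / G')"
  have "y\<^sup>2 = - 2 / G'" using neg by (simp add: y_def)
  then have y: "y * y * G' = - 2" using \<open>\<not> G' \<ge> 0\<close> by (simp add: power2_eq_square)
  let ?T = "(0, 0, 1) :: heis"
  define Ev where "Ev = hor (pt 0 0 t) d2 (- d1)"
  define Dv where "Dv = hor (pt 0 0 t) d1 d2"
  have q: "rot_pt d1 d2 x y s = pt 0 0 t + x *\<^sub>R Ev + y *\<^sub>R Dv + (s - t) *\<^sub>R ?T" for x y s
    using rot_pt_affine unfolding Ev_def Dv_def .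
  define p where "p = rot_pt d1 d2 (y * G t) y t"
  have p: "p \<in> S" using iff t by (simp add: p_def)
  have "((\<lambda>s. rot_pt d1 d2 (s * G t) s t) has_vector_derivative (G t *\<^sub>R Ev + Dv)) (at y)"
    unfolding q has_vector_derivative_def by (auto intro!: derivative_eq_intros simp: algebra_simps)
  then have t1: "tangent p (G t *\<^sub>R Ev + Dv)"
    unfolding p_def by (rule tangent_curve[OF _ zero_less_one]) (use iff t in auto)
  have "((\<lambda>s. rot_pt d1 d2 (y * G s) y s) has_vector_derivative ((y * G') *\<^sub>R Ev + ?T)) (at t)"
    unfolding q has_vector_derivative_def
    by (auto intro!: derivative_eq_intros G[unfolded has_field_derivative_def] simp: algebra_simps)
  then have t2: "tangent p ((y * G') *\<^sub>R Ev + ?T)"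
    unfolding p_def
  proof (rule tangent_curve)
    show "r - \<bar>t - t0\<bar> > 0" using t by simp
    show "rot_pt d1 d2 (y * G s) y s \<in> S" if "\<bar>s - t\<bar> < r - \<bar>t - t0\<bar>" for s
      using that by (intro iff[THEN iffD2]) auto
  qed
  \<comment> \<open>For this \<open>y\<close> suitable combinations of the two curve velocities lose
    their excess in \<open>Ev\<close> and become the two vectors that span the horizontal plane at
    \<open>p\<close>.\<close>
  have "(- y / 2) * (y * G') = 1" using y by simp
  then have "(- y / 2) *\<^sub>R ((y * G') *\<^sub>R Ev + ?T) = Ev + (- y / 2) *\<^sub>R ?T"
    by (simp only: scaleR_right_distrib scaleR_scaleR scaleR_one)
  then have "tangent p (Ev + (- y / 2) *\<^sub>R ?T)"
    using tangent_add_scale[OF t2 t2, of "- y / 2" 0]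
    by (simp only: scaleR_zero_left add_0_right)
  then have h1: "tangent p (hor p d2 (- d1))"
    unfolding p_def Ev_def hor_rot_pt[OF d, of _ _ _ t] .
  have "(y * G t / 2) * (y * G') = - G t" using y by algebra
  then have eq: "1 *\<^sub>R (G t *\<^sub>R Ev + Dv) + (y * G t / 2) *\<^sub>R ((y * G') *\<^sub>R Ev + ?T) = Dv + (y * G t / 2) *\<^sub>R ?T"
    by (simp only: scaleR_right_distrib scaleR_scaleR scaleR_one) (simp add: scaleR_minus_left)
  then have "tangent p (Dv + (y * G t / 2) *\<^sub>R ?T)"
    using tangent_add_scale[OF t1 t2, of 1 "y * G t / 2"] by (simp only: eq)
  then have h2: "tangent p (hor p d1 d2)"
    unfolding p_def Dv_def hor_rot_pt[OF d, of _ _ _ t] .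
  have "d2 * d2 = d1 * (- d1)" using tangent_hor_unique[OF p h1 h2] by simp
  then have "d1\<^sup>2 + d2\<^sup>2 = 0" by (simp add: power2_eq_square)
  then show False using d by simp
qed

text \<open>This angle turns \<open>(d1, d2)\<close> into (0, 1), so the strips constructed here
  have the form x = y G(t).\<close>

lemma translate_rotate_rot_pt:
  assumes "sin \<theta> = d1" "cos \<theta> = d2"
  shows "rotation_t \<theta> ((- x0, - y0, 0) \<circ>\<^sub>H rot_pt d1 d2 x y t) = (x, y, t)"
proof -
  have d: "d1\<^sup>2 + d2\<^sup>2 = 1" using assms sin_cos_squared_add by blast
  let ?a = "x * d2 + y * d1" and ?b = "y * d2 - x * d1"
  have 1: "?a * d2 - ?b * d1 = x" "?a * d1 + ?b * d2 = y"
    using d by algebra+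
  have "(- x0, - y0, 0) \<circ>\<^sub>H pt a b t = (a, b, t)" for a b
    by (simp add: heis_mult_def axis_pt_def field_simps)
  then have "rotation_t \<theta> ((- x0, - y0, 0) \<circ>\<^sub>H rot_pt d1 d2 x y t) = rotation_t \<theta> (?a, ?b, t)"
    by (simp only: rot_pt_def)
  also have "\<dots> = (?a * d2 - ?b * d1, ?a * d1 + ?b * d2, t)"
    unfolding rotation_t_def assms by (simp only: prod.case)
  also have "\<dots> = (x, y, t)" by (simp only: 1)
  finally show ?thesis .
qed

lemma C2_surface_Int_open:
  assumes "open V"
  shows "C2_surface (S \<inter> V)"
  unfolding C2_surface_def
proof
  fix g assume g: "g \<in> S \<inter> V"
  then have "g \<in> S" by simp
  then obtain U \<phi> where S: "C2_defining_function S U \<phi>" "g \<in> U" by (rule chart)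
  have "C2_defining_function (S \<inter> V) (U \<inter> V) \<phi>"
    using S(1) assms C2_on_subset[of \<phi> U "U \<inter> V"] unfolding C2_defining_function_def by blast
  then show "\<exists>U \<phi>. g \<in> U \<and> C2_defining_function (S \<inter> V) U \<phi>" using S(2) g by blast
qed

text \<open>Where \<open>G'\<close> is positive, its continuity provides \<open>J\<close>, and the
  slab of S over \<open>I\<close> is a strict strip. Otherwise \<open>G\<close> is constant, with
  value 0 because the frame is aligned with the line at height \<open>t0\<close>.\<close>

lemma strict_strip_or_constant:
  assumes d: "d1\<^sup>2 + d2\<^sup>2 = 1" and S0: "pt d1 d2 t0 \<in> S"
    and no: "\<not> (\<exists>S0 \<subseteq> S. strict_graphical_strip S0)"
  shows "\<exists>r>0. \<forall>t. \<bar>t - t0\<bar> < r \<longrightarrow> pt d1 d2 t \<in> S"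
proof -
  from local_strip[OF d S0] obtain r G G' where r: "r > 0"
    and iff': "\<forall>x y t. \<bar>t - t0\<bar> < r \<longrightarrow> (rot_pt d1 d2 x y t \<in> S \<longleftrightarrow> x = y * G t)"
    and G_der: "\<forall>t. \<bar>t - t0\<bar> < r \<longrightarrow> (G has_real_derivative G' t) (at t)"
    and G': "C1_on G' {t0 - r<..<t0 + r}"
    by (elim exE conjE)
  note iff = iff'[rule_format] and G = G_der[rule_format]
  define I where "I = {t0 - r<..<t0 + r}"
  have I: "t \<in> I \<longleftrightarrow> \<bar>t - t0\<bar> < r" for t by (auto simp: I_def)
  have nonneg: "G' t \<ge> 0" if "t \<in> I" for t
  proof (rule strip_derivative_nonneg[OF d])
    show "rot_pt d1 d2 x y s \<in> S \<longleftrightarrow> x = y * G s" if "\<bar>s - t0\<bar> < r" for x y s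
      using that by (rule iff)
    show "\<bar>t - t0\<bar> < r" using that I by simp
    then show "(G has_real_derivative G' t) (at t)" by (rule G)
  qed
  have "G' t = 0" if t: "t \<in> I" for t
  proof (rule ccontr)
    assume "G' t \<noteq> 0"
    then have pos: "G' t > 0" using nonneg[OF t] by simp
    have "isCont G' t"
      using C1_on_continuous_on[OF G'] t
      by (simp add: continuous_on_eq_continuous_at[OF open_greaterThanLessThan] I_def)
    then have "eventually (\<lambda>s. G' s > 0) (nhds t)"
      using pos order_tendstoD(1)[of G' "G' t" "nhds t" 0] tendsto_at_iff_tendsto_nhds[of G' t]
      unfolding isCont_def by blast
    moreover have "eventually (\<lambda>s. s \<in> I) (nhds t)"
      using t by (intro eventually_nhds_in_open) (auto simp: I_def)
    ultimately have "eventually (\<lambda>s. G' s > 0 \<and> s \<in> I) (nhds t)" by (rule eventually_conj)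
    then obtain e where e: "e > 0" "\<And>s. \<bar>s - t\<bar> < e \<Longrightarrow> G' s > 0 \<and> s \<in> I"
      by (auto simp: eventually_nhds_metric dist_real_def)
    define J where "J = {t - e<..<t + e}"
    have J: "G' s > 0 \<and> s \<in> I" if "s \<in> J" for s using that by (intro e) (auto simp: J_def)
    define V where "V = ht -` I"
    have "open V" unfolding V_def using continuous_on_ht by (auto intro!: open_vimage simp: I_def)
    obtain \<theta> where \<theta>: "cos \<theta> = d2" "sin \<theta> = d1"
      using sincos_total_2pi[of d2 d1] d by (metis add.commute)
    have deriv: "deriv G s = G' s" if "s \<in> I" for s using G I that DERIV_imp_deriv by blast
    have SV: "g \<in> S \<inter> V \<longleftrightarrow> (\<exists>y t. t \<in> I \<and> g = rot_pt d1 d2 (y * G t) y t)" for g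
    proof
      assume g: "g \<in> S \<inter> V"
      define a b where "a = fst g - x0" and "b = fst (snd g) - y0"
      have gq: "g = rot_pt d1 d2 (a * d2 - b * d1) (a * d1 + b * d2) (ht g)"
        using pt_ht[of g] pt_eq_rot_pt[OF d] by (simp add: a_def b_def)
      moreover have hI: "ht g \<in> I" using g by (simp add: V_def)
      ultimately have "a * d2 - b * d1 = (a * d1 + b * d2) * G (ht g)"
        using iff[of "ht g"] I g by (metis IntD1)
      then show "\<exists>y t. t \<in> I \<and> g = rot_pt d1 d2 (y * G t) y t"
        using gq hI by metis
    next
      assume "\<exists>y t. t \<in> I \<and> g = rot_pt d1 d2 (y * G t) y t"
      then show "g \<in> S \<inter> V" using iff I by (auto simp: V_def rot_pt_def)
    qed
    have im: "(\<lambda>g. rotation_t \<theta> ((- x0, - y0, 0) \<circ>\<^sub>H g)) ` (S \<inter> V) = {(x, y, t). t \<in> I \<and> x = y * G t}"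
      (is "?F ` _ = ?R")
    proof (intro equalityI subsetI)
      fix z assume "z \<in> ?F ` (S \<inter> V)"
      then obtain g where g: "g \<in> S \<inter> V" and z: "z = ?F g" by blast
      obtain y t where yt: "t \<in> I" "g = rot_pt d1 d2 (y * G t) y t" using SV[of g] g by blast
      have "z = (y * G t, y, t)" unfolding z yt(2) by (rule translate_rotate_rot_pt[OF \<theta>(2,1)])
      then show "z \<in> ?R" using yt(1) by simp
    next
      fix z assume "z \<in> ?R"
      then obtain y t where z: "z = (y * G t, y, t)" "t \<in> I" by auto
      then have "rot_pt d1 d2 (y * G t) y t \<in> S \<inter> V" using SV by blast
      then show "z \<in> ?F ` (S \<inter> V)"
        using translate_rotate_rot_pt[OF \<theta>(2,1), of "y * G t" y t] z image_iff by metis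
    qed
    have "C2_on G I" using C2_onI_real[of I G G'] G G' I by (auto simp: I_def)
    then have "graphical_strip_with I G (S \<inter> V)"
      unfolding graphical_strip_with_def
      using C2_surface_Int_open[OF \<open>open V\<close>] t deriv nonneg im by (auto simp: I_def is_interval_oo)
    moreover have "J \<subseteq> I" "J \<noteq> {}" "open J" "is_interval J" "\<forall>s\<in>J. deriv G s > 0"
      using J deriv e(1) by (auto simp: J_def is_interval_oo)
    ultimately have "strict_graphical_strip (S \<inter> V)" unfolding strict_graphical_strip_def by blast
    then show False using no by blast
  qed
  then have "(G has_real_derivative 0) (at t)" if "t \<in> I" for t
    using G that I by metis
  then have const: "G t = G t0" if "t \<in> I" for t
    using DERIV_isconst3[of "t0 - r" "t0 + r" t t0 G] that r by (auto simp: I_def)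
  have d0: "rot_pt d1 d2 0 1 t = pt d1 d2 t" for t by (simp add: rot_pt_def)
  have "G t0 = 0" using iff[of t0 0 1] r S0 d0 by simp
  then have "pt d1 d2 t \<in> S" if "\<bar>t - t0\<bar> < r" for t
    using iff[OF that, of 0 1] const[of t] I that d0 by simp
  then show ?thesis using r by blast
qed

lemma vertical_plane_if_no_strict_strip:
  assumes no: "\<not> (\<exists>S0 \<subseteq> S. strict_graphical_strip S0)"
  shows "vertical_plane S"
proof -
  have ax: "pt 0 0 (ht g) \<in> S" if "g \<in> S" for g
    using pt_ht[of g] that pt_axis by metis
  define p where "p = foot 0"
  have "p \<in> S" using foot_in p_def by simp
  then obtain d1 d2 where d: "d1\<^sup>2 + d2\<^sup>2 = 1" "pt d1 d2 (ht p) \<in> S"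
    by (rule ex_unit_direction[OF ax])
  \<comment> \<open>Tests whether the line at height \<open>t\<close> has the same planar direction
    as the line at the height of \<open>p\<close>.\<close>
  define f where "f = (\<lambda>t. pt d1 d2 t \<in> S)"
  have conn: "connected (ht ` S)"
    using connected_continuous_image[OF continuous_on_ht connected_S] .
  have "f t = f (ht p)" if "t \<in> ht ` S" for t
  proof (rule connected_local_const[OF conn that])
    show "ht p \<in> ht ` S" using \<open>p \<in> S\<close> by blast
    show "\<forall>a\<in>ht ` S. eventually (\<lambda>b. f a = f b) (at a within ht ` S)"
    proof
      fix a assume "a \<in> ht ` S"
      then have "pt 0 0 a \<in> S" using ax by blast
      then obtain e1 e2 where e: "e1\<^sup>2 + e2\<^sup>2 = 1" "pt e1 e2 a \<in> S" by (rule ex_unit_direction)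
      have fe: "f b \<longleftrightarrow> e1 * d2 = d1 * e2" if "pt e1 e2 b \<in> S" for b
      proof
        assume "f b"
        then show "e1 * d2 = d1 * e2" using pt_parallel that unfolding f_def by blast
      next
        assume eq: "e1 * d2 = d1 * e2"
        \<comment> \<open>Parallel unit vectors agree up to sign, and the sign is their inner
          product.\<close>
        have "(e1 * d1 + e2 * d2) * e1 = d1 * (e1\<^sup>2 + e2\<^sup>2)"
          "(e1 * d1 + e2 * d2) * e2 = d2 * (e1\<^sup>2 + e2\<^sup>2)"
          using eq by algebra+
        then show "f b" using pt_scale[OF that, of "e1 * d1 + e2 * d2"] e(1) by (simp add: f_def)
      qed
      obtain r where r: "r > 0" "\<And>t. \<bar>t - a\<bar> < r \<Longrightarrow> pt e1 e2 t \<in> S"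
        using strict_strip_or_constant[OF e no] by blast
      then have "f a = f b" if "dist b a < r" for b
        using fe[of a] fe[of b] e(2) that by (simp add: dist_real_def)
      then show "eventually (\<lambda>b. f a = f b) (at a within ht ` S)"
        unfolding eventually_at using r(1) by blast
    qed
  qed
  then have all: "pt d1 d2 (ht g) \<in> S" if "g \<in> S" for g
    using that d(2) by (auto simp: f_def)
  define Pl where "Pl = {(x, y, t :: real). d2 * x + (- d1) * y = d2 * x0 - d1 * y0}"
  have sub: "g \<in> Pl" if "g \<in> S" for g
  proof -
    have "d1 * (fst (snd g) - y0) = (fst g - x0) * d2"
      using pt_parallel[OF all[OF that], of "fst g - x0" "fst (snd g) - y0"] pt_ht[of g] that by simp
    then show ?thesis by (cases g) (simp add: Pl_def algebra_simps)
  qed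
  have dnz: "(d2, - d1) \<noteq> (0, 0)" using d(1) by auto
  obtain n1 n2 n3 where n: "n = (n1, n2, n3)" by (cases n) auto
  \<comment> \<open>A point of \<open>Pl\<close> and its \<open>foot\<close> both lie in
    \<open>Pl\<close> and differ by a multiple of n. As n is not parallel to \<open>Pl\<close>, they
    are equal.\<close>
  have "Pl \<subseteq> S"
  proof
    fix z assume z: "z \<in> Pl"
    obtain s where s: "foot z = z + s *\<^sub>R n" using foot_decompose by blast
    have "z + s *\<^sub>R n \<in> Pl" using sub[OF foot_in[of z]] s by simp
    obtain x y t where xyt: "z = (x, y, t)" by (cases z) auto
    have "d2 * (x + s * n1) + (- d1) * (y + s * n2) = d2 * x0 - d1 * y0"
      "d2 * x + (- d1) * y = d2 * x0 - d1 * y0"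
      using z \<open>z + s *\<^sub>R n \<in> Pl\<close> by (simp_all add: Pl_def xyt n)
    then have "s * (d2 * n1 - d1 * n2) = 0" by algebra
    moreover have "d2 * n1 - d1 * n2 \<noteq> 0"
    proof
      assume 0: "d2 * n1 - d1 * n2 = 0"
      \<comment> \<open>A point off \<open>Pl\<close>: if n were parallel to \<open>Pl\<close>, the
        line along n through it would miss S.\<close>
      define u :: heis where "u = (x0 + d2, y0 - d1, 0)"
      obtain s' where "foot u = u + s' *\<^sub>R n" using foot_decompose by blast
      then have "u + s' *\<^sub>R n \<in> Pl" using sub[OF foot_in[of u]] by simp
      then have "d2 * d2 + d1 * d1 + s' * (d2 * n1 - d1 * n2) = 0"
        by (simp add: Pl_def n u_def algebra_simps)
      then show False using d(1) 0 by (simp add: power2_eq_square)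
    qed
    ultimately have "s = 0" by simp
    then show "z \<in> S" using foot_in[of z] s by simp
  qed
  then have "S = Pl" using sub by blast
  then show ?thesis unfolding vertical_plane_def Pl_def using dnz by blast
qed

end

text \<open>Every line in the normal direction of the base plane crosses that plane, so base points
  in the plane can be replaced by arbitrary points of space; n being nonzero turns a unique point
  into a unique parameter.\<close>

lemma entire_graph_line_unique:
  assumes "entire_graph S"
  obtains n where "\<And>z. \<exists>!s. z + s *\<^sub>R n \<in> S"
proof -
  obtain a b c \<gamma> where abc: "(a, b, c) \<noteq> (0, 0, 0)"
    and ex1: "\<forall>g0 \<in> {(x, y, t). a * x + b * y + c * t = \<gamma>}.
      \<exists>!p. p \<in> S \<inter> range (\<lambda>s. g0 + s *\<^sub>R (a, b, c))"
    using assms unfolding entire_graph_def by (elim conjE exE)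
  define n :: heis where "n = (a, b, c)"
  have "n \<noteq> 0" using abc by (simp add: n_def zero_prod_def)
  have nn: "a * a + b * b + c * c \<noteq> 0"
  proof -
    have "n \<bullet> n \<noteq> 0" using \<open>n \<noteq> 0\<close> by simp
    moreover have "n \<bullet> n = a * a + b * b + c * c" by (simp add: n_def)
    ultimately show ?thesis by metis
  qed
  have "\<exists>!s. z + s *\<^sub>R n \<in> S" for z
  proof -
    obtain x y t where z: "z = (x, y, t)" by (cases z) auto
    \<comment> \<open>The parameter at which the line through \<open>z\<close> crosses the base
      plane.\<close>
    define s0 where "s0 = (\<gamma> - (a * x + b * y + c * t)) / (a * a + b * b + c * c)"
    have "s0 * (a * a + b * b + c * c) = \<gamma> - (a * x + b * y + c * t)" using nn by (simp add: s0_def)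
    then have "a * (x + s0 * a) + b * (y + s0 * b) + c * (t + s0 * c) = \<gamma>" by (simp add: algebra_simps)
    then have "z + s0 *\<^sub>R n \<in> {(x, y, t). a * x + b * y + c * t = \<gamma>}" by (simp add: z n_def)
    from bspec[OF ex1 this]
    have u: "\<exists>!p. p \<in> S \<inter> range (\<lambda>s. z + s0 *\<^sub>R n + s *\<^sub>R n)" by (simp only: n_def)
    then obtain p where "p \<in> S \<inter> range (\<lambda>s. z + s0 *\<^sub>R n + s *\<^sub>R n)" by (rule ex1E)
    then obtain s where p: "p \<in> S" "p = z + s0 *\<^sub>R n + s *\<^sub>R n" by blast
    show ?thesis
    proof (rule ex1I[of _ "s0 + s"])
      show "z + (s0 + s) *\<^sub>R n \<in> S" using p by (simp add: scaleR_left_distrib add.assoc)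
      fix s' assume s': "z + s' *\<^sub>R n \<in> S"
      have "z + s' *\<^sub>R n = z + s0 *\<^sub>R n + (s' - s0) *\<^sub>R n" by (simp add: algebra_simps)
      then have "z + s' *\<^sub>R n \<in> S \<inter> range (\<lambda>s. z + s0 *\<^sub>R n + s *\<^sub>R n)"
        using s' by (metis IntI rangeI)
      moreover have "p \<in> S \<inter> range (\<lambda>s. z + s0 *\<^sub>R n + s *\<^sub>R n)" using p by blast
      ultimately have "z + s' *\<^sub>R n = p" using the1_equality[OF u] by metis
      then have "(s' - (s0 + s)) *\<^sub>R n = 0" using p(2) by (simp add: algebra_simps)
      then show "s' = s0 + s" using \<open>n \<noteq> 0\<close> by simp
    qed
  qed
  then show thesis by (rule that)
qed

theorem theorem1p7:
  fixes S :: "heis set"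
  assumes "entire_graph S"
    and "characteristic_locus S = {}"
    and "H_minimal S"
    and "\<not> vertical_plane S"
  shows "\<exists>S0 \<subseteq> S. strict_graphical_strip S0"
proof (rule ccontr)
  assume no: "\<not> ?thesis"
  obtain n where n: "\<And>z. \<exists>!s. z + s *\<^sub>R n \<in> S"
    using entire_graph_line_unique[OF assms(1)] by blast
  interpret minimal_graph S n
  proof
    show "C2_surface S" using assms(1) unfolding entire_graph_def by (rule conjunct1)
  qed (use assms n in blast)+
  obtain x0 y0 where "\<forall>g a b. line_in g a b \<longrightarrow> a * (fst (snd g) - y0) = b * (fst g - x0)"
    using ex_axis by blast
  then interpret axial_minimal_graph S n x0 y0
    by unfold_locales blast
  show False using vertical_plane_if_no_strict_strip[OF no] assms(4) by blast
qed

end
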